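(* Let $R$ be a field, $g=(g_1,\ldots,g_s)\in\mathbb Z_{>0}^s$, and let $\mathcal O$ be a finite-dimensional commutative local principal $R$-algebra of Loewy length $\sum_ig_i$. Let $A_g$, the family of basic tilting $A_g$-modules $\{T_w\mid w\in\Sigma_s\}$, the sets $I_a$, and the subgroup $H_g\le\Sigma_s$ be as described in the context. For $u,v\in\Sigma_s$, \[ \operatorname{End}_{A_g}(T_u)^{\mathrm{op}}\simeq\operatorname{End}_{A_g}(T_v)^{\mathrm{op}}\ (\text{as }R\text{-algebras})\quad\Longleftrightarrow\quad H_gu=H_gv. \] Consequently, the labeled quotient of the mutation graph obtained by identifying vertices with isomorphic opposite endomorphism algebras is $\operatorname{Sch}(H_g\backslash\Sigma_s;s_1,\ldots,s_{s-1})$. The right weak-order orientation descends to the nonloop edges of this quotient if and only if every $I_a$ is an interval in $\{1,\ldots,s\}$.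
   Context: Modules are finitely generated left modules. A local principal algebra is a local ring in which every ideal is principal; the Loewy length is the least $r$ with $\operatorname{rad}^r\mathcal O=0$. For $h\in\mathbb Z_{>0}^s$ with $\sum_ih_i=\sum_ig_i$ put $q_i(h)=\sum_{j\le i}h_j$, $A_h=\operatorname{End}_{\mathcal O}(\bigoplus_{i=1}^s\mathcal O/\operatorname{rad}^{q_i(h)}\mathcal O)$, and let $e_i^h$ be the projection onto the $i$th summand. $\Sigma_s$ acts by $(g\cdot w)_j=g_{w(j)}$; $s_i=(i,i+1)$; $\ell$ is the Coxeter length. Tilting modules are classical: $\operatorname{pd}T\le1$, $\operatorname{Ext}^1(T,T)=0$, and there is an exact sequence $0\to A\to T_0\to T_1\to0$ with $T_0,T_1\in\operatorname{add}T$; they are ordered by $T\le T'$ iff $\operatorname{Fac}T\subseteq\operatorname{Fac}T'$ ($\operatorname{Fac}T$: factor modules of finite direct sums of copies of $T$). The family: $\{T_w=T_{w,1}\oplus\cdots\oplus T_{w,s}\mid w\in\Sigma_s\}$ ($T_{w,j}$ indecomposable, with label $j$) is a complete irredundant set of representatives of the isomorphism classes of basic tilting $A_g$-modules, with $T_1=A_g$, $T_{1,j}=A_ge_j^g$, $\operatorname{End}_{A_g}(T_w)^{\mathrm{op}}\simeq A_{g\cdot w}$, and such that whenever $\ell(ws_i)=\ell(w)+1$, $T_{ws_i}$ is obtained from $T_w$ by replacing only the summand with label $i$ (the replacement again has label $i$) and $T_{ws_i}<T_w$. (Such a family exists and, up to isomorphism, is determined by these properties.) For each value $a$ occurring in $g$,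 $I_a=\{j\mid g_j=a\}$. $H_g=\{h\in\Sigma_s\mid g\cdot h=g\}=\prod_a\operatorname{Sym}(I_a)$. An interval is a set of consecutive integers. Mutation graph: the undirected labeled graph $\mathcal G_g$ with vertices $T_w$ and an edge with label $i$ joining $T_w$ and $T_{ws_i}$. $H_g$ acts on it by $h\cdot T_w=T_{hw}$; the labeled quotient has as vertices and edges the $H_g$-orbits of vertices and of labeled edges (the vertex orbits being the classes of vertices with isomorphic opposite endomorphism algebras), retaining loops and parallel edges. $\operatorname{Sch}(H_g\backslash\Sigma_s;s_1,\ldots,s_{s-1})$: the undirected labeled multigraph with vertex set $X_g=H_g\backslash\Sigma_s$ (cosets $H_gw$) and edge set $\bigsqcup_{i=1}^{s-1}X_g/\langle\rho_i\rangle$, where $\rho_i(H_gw)=H_gws_i$; an orbit in the $i$th part is an edge with label $i$ joining its elements, and a singleton orbit is a loop. Orientation: the right weak order orients the edge of $\mathcal G_g$ between $T_w$ and $T_{ws_i}$ from $w$ to $ws_i$ when $\ell(ws_i)=\ell(w)+1$. The orientation descends if for every nonloop quotient edge, represented by $\{H_gw,H_gws_i\}$, all of its lifts $\{T_{hw},T_{hws_i}\}$, $h\in H_g$, have the same direction (all from $hw$ to $hws_i$, or all from $hws_i$ to $hw$). *)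

theory Defs
  imports "HOL-Algebra.Module" "HOL-Algebra.QuotRing" "HOL-Algebra.Ideal_Product"
    "HOL-Algebra.Group_Action" "HOL-Algebra.Sym_Groups"
begin

section \<open>Left modules over a not necessarily commutative ring\<close>

text \<open>
  The locale \<^locale>\<open>module\<close> of the library requires a commutative ring of scalars. We keep its record
  and drop commutativity. As in the library, the ring fields \<^const>\<open>monoid.mult\<close> and \<^const>\<open>one\<close> of a module
  record carry no information.
\<close>

locale lmodule = A?: ring A + M?: abelian_group M
  for A :: "('b, 'x) ring_scheme" (structure) and M :: "('b, 'm, 'y) module_scheme" (structure) +
  assumes smult_closed:
      "\<lbrakk>a \<in> carrier A; x \<in> carrier M\<rbrakk> \<Longrightarrow> a \<odot>\<^bsub>M\<^esub> x \<in> carrier M"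
    and smult_l_distr:
      "\<lbrakk>a \<in> carrier A; b \<in> carrier A; x \<in> carrier M\<rbrakk> \<Longrightarrow>
        (a \<oplus>\<^bsub>A\<^esub> b) \<odot>\<^bsub>M\<^esub> x = a \<odot>\<^bsub>M\<^esub> x \<oplus>\<^bsub>M\<^esub> b \<odot>\<^bsub>M\<^esub> x"
    and smult_r_distr:
      "\<lbrakk>a \<in> carrier A; x \<in> carrier M; y \<in> carrier M\<rbrakk> \<Longrightarrow>
        a \<odot>\<^bsub>M\<^esub> (x \<oplus>\<^bsub>M\<^esub> y) = a \<odot>\<^bsub>M\<^esub> x \<oplus>\<^bsub>M\<^esub> a \<odot>\<^bsub>M\<^esub> y"
    and smult_assoc:
      "\<lbrakk>a \<in> carrier A; b \<in> carrier A; x \<in> carrier M\<rbrakk> \<Longrightarrow>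
        (a \<otimes>\<^bsub>A\<^esub> b) \<odot>\<^bsub>M\<^esub> x = a \<odot>\<^bsub>M\<^esub> (b \<odot>\<^bsub>M\<^esub> x)"
    and smult_one: "x \<in> carrier M \<Longrightarrow> \<one>\<^bsub>A\<^esub> \<odot>\<^bsub>M\<^esub> x = x"

definition fin_gen :: "('b, 'x) ring_scheme \<Rightarrow> ('b, 'm, 'y) module_scheme \<Rightarrow> bool" where
  "fin_gen A M \<longleftrightarrow>
     (\<exists>S. finite S \<and> S \<subseteq> carrier M \<and> (\<forall>N. submodule N A M \<and> S \<subseteq> N \<longrightarrow> N = carrier M))"

definition fg_module :: "('b, 'x) ring_scheme \<Rightarrow> ('b, 'm, 'y) module_scheme \<Rightarrow> bool" where
  "fg_module A M \<longleftrightarrow> lmodule A M \<and> fin_gen A M"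

text \<open>
  Every finitely generated left module over a ring with elements in \<^typ>\<open>'b\<close> is isomorphic to a quotient
  of some \<open>A\<^sup>n\<close>, whose elements are cosets, that is, sets of functions \<^typ>\<open>nat \<Rightarrow> 'b\<close>. Hence the
  following type contains, up to isomorphism, all finitely generated left modules over such a ring;
  quantifiers over all finitely generated modules range over it.
\<close>

type_synonym 'b fgm = "('b, (nat \<Rightarrow> 'b) set) module"

definition mod_hom ::
    "('b, 'x) ring_scheme \<Rightarrow> ('b, 'm, 'y) module_scheme \<Rightarrow> ('b, 'n, 'z) module_scheme \<Rightarrow> ('m \<Rightarrow> 'n) set"
  where
  "mod_hom A M N = {f \<in> carrier M \<rightarrow> carrier N.
     (\<forall>x\<in>carrier M. \<forall>y\<in>carrier M. f (x \<oplus>\<^bsub>M\<^esub> y) = f x \<oplus>\<^bsub>N\<^esub> f y) \<and>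
     (\<forall>a\<in>carrier A. \<forall>x\<in>carrier M. f (a \<odot>\<^bsub>M\<^esub> x) = a \<odot>\<^bsub>N\<^esub> f x)}"

definition mod_iso ::
    "('b, 'x) ring_scheme \<Rightarrow> ('b, 'm, 'y) module_scheme \<Rightarrow> ('b, 'n, 'z) module_scheme \<Rightarrow> bool" where
  "mod_iso A M N \<longleftrightarrow> (\<exists>f\<in>mod_hom A M N. bij_betw f (carrier M) (carrier N))"

definition dsum :: "nat set \<Rightarrow> (nat \<Rightarrow> ('b, 'm) module) \<Rightarrow> ('b, nat \<Rightarrow> 'm) module" where
  "dsum I M = \<lparr>carrier = (\<Pi>\<^sub>E i\<in>I. carrier (M i)),
     monoid.mult = undefined, one = undefined,
     ring.zero = (\<lambda>i\<in>I. \<zero>\<^bsub>M i\<^esub>),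
     add = (\<lambda>x y. \<lambda>i\<in>I. x i \<oplus>\<^bsub>M i\<^esub> y i),
     smult = (\<lambda>a x. \<lambda>i\<in>I. a \<odot>\<^bsub>M i\<^esub> x i)\<rparr>"

definition dsum2 :: "('b, 'm) module \<Rightarrow> ('b, 'n) module \<Rightarrow> ('b, 'm \<times> 'n) module" where
  "dsum2 M N = \<lparr>carrier = carrier M \<times> carrier N,
     monoid.mult = undefined, one = undefined,
     ring.zero = (\<zero>\<^bsub>M\<^esub>, \<zero>\<^bsub>N\<^esub>),
     add = (\<lambda>(x, y) (x', y'). (x \<oplus>\<^bsub>M\<^esub> x', y \<oplus>\<^bsub>N\<^esub> y')),
     smult = (\<lambda>a (x, y). (a \<odot>\<^bsub>M\<^esub> x, a \<odot>\<^bsub>N\<^esub> y))\<rparr>"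

abbreviation mod_power :: "('b, 'm) module \<Rightarrow> nat \<Rightarrow> ('b, nat \<Rightarrow> 'm) module" where
  "mod_power M n \<equiv> dsum {..<n} (\<lambda>_. M)"

definition regular_module :: "('b, 'x) ring_scheme \<Rightarrow> ('b, 'b) module" where
  "regular_module A = \<lparr>carrier = carrier A, monoid.mult = monoid.mult A, one = \<one>\<^bsub>A\<^esub>, ring.zero = \<zero>\<^bsub>A\<^esub>, add = add A,
     smult = monoid.mult A\<rparr>"

definition left_ideal_module :: "('b, 'x) ring_scheme \<Rightarrow> 'b \<Rightarrow> ('b, 'b) module" where
  "left_ideal_module A e = (regular_module A)\<lparr>carrier := {a \<otimes>\<^bsub>A\<^esub> e | a. a \<in> carrier A}\<rparr>"

definition quot_module :: "('a, 'x) ring_scheme \<Rightarrow> 'a set \<Rightarrow> ('a, 'a set) module" where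
  "quot_module P I = \<lparr>carrier = carrier (P Quot I), monoid.mult = monoid.mult (P Quot I), one = \<one>\<^bsub>P Quot I\<^esub>,
     ring.zero = \<zero>\<^bsub>P Quot I\<^esub>, add = add (P Quot I),
     smult = (\<lambda>a X. (I +>\<^bsub>P\<^esub> a) \<otimes>\<^bsub>P Quot I\<^esub> X)\<rparr>"

definition indecomposable :: "('b, 'x) ring_scheme \<Rightarrow> ('b, 'm, 'y) module_scheme \<Rightarrow> bool" where
  "indecomposable A M \<longleftrightarrow> lmodule A M \<and> carrier M \<noteq> {\<zero>\<^bsub>M\<^esub>} \<and>
     (\<forall>X Y. submodule X A M \<and> submodule Y A M \<and> X \<inter> Y = {\<zero>\<^bsub>M\<^esub>} \<and> X <+>\<^bsub>M\<^esub> Y = carrier M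
        \<longrightarrow> X = {\<zero>\<^bsub>M\<^esub>} \<or> Y = {\<zero>\<^bsub>M\<^esub>})"

definition basic_module :: "('b, 'x) ring_scheme \<Rightarrow> ('b, 'm, 'y) module_scheme \<Rightarrow> bool" where
  "basic_module A M \<longleftrightarrow>
     (\<exists>n (X :: nat \<Rightarrow> 'b fgm). (\<forall>i<n. indecomposable A (X i)) \<and>
        (\<forall>i<n. \<forall>j<n. mod_iso A (X i) (X j) \<longrightarrow> i = j) \<and>
        mod_iso A M (dsum {..<n} X))"


section \<open>Classical tilting modules\<close>

text \<open>For finitely generated \<open>P\<close> it suffices to lift along surjections of finitely generated modules.\<close>

definition projective :: "('b, 'x) ring_scheme \<Rightarrow> ('b, 'm, 'y) module_scheme \<Rightarrow> bool" where
  "projective A P \<longleftrightarrow> fg_module A P \<and>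
     (\<forall>(M :: 'b fgm) (N :: 'b fgm). fg_module A M \<and> fg_module A N \<longrightarrow>
        (\<forall>p\<in>mod_hom A M N. \<forall>f\<in>mod_hom A P N. p ` carrier M = carrier N \<longrightarrow>
           (\<exists>f'\<in>mod_hom A P M. \<forall>x\<in>carrier P. p (f' x) = f x)))"

text \<open>Exactness of \<open>0 \<rightarrow> X \<rightarrow> Y \<rightarrow> Z \<rightarrow> 0\<close>, with maps \<open>i\<close> and \<open>p\<close>.\<close>

definition short_exact :: "('b, 'x) ring_scheme \<Rightarrow> ('b, 'k, 'u) module_scheme \<Rightarrow>
    ('b, 'm, 'v) module_scheme \<Rightarrow> ('b, 'n, 'w) module_scheme \<Rightarrow> ('k \<Rightarrow> 'm) \<Rightarrow> ('m \<Rightarrow> 'n) \<Rightarrow> bool" where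
  "short_exact A X Y Z i p \<longleftrightarrow> i \<in> mod_hom A X Y \<and> p \<in> mod_hom A Y Z \<and>
     inj_on i (carrier X) \<and> p ` carrier Y = carrier Z \<and>
     i ` carrier X = {y \<in> carrier Y. p y = \<zero>\<^bsub>Z\<^esub>}"

definition pd_le_1 :: "('b, 'x) ring_scheme \<Rightarrow> ('b, 'm, 'y) module_scheme \<Rightarrow> bool" where
  "pd_le_1 A M \<longleftrightarrow> (\<exists>(P1 :: 'b fgm) (P0 :: 'b fgm) i p.
     projective A P1 \<and> projective A P0 \<and> short_exact A P1 P0 M i p)"

text \<open>
  \<open>Ext\<^sup>1\<close> in the sense of Yoneda: equivalence classes of extensions \<open>0 \<rightarrow> N \<rightarrow> E \<rightarrow> M \<rightarrow> 0\<close>. The class of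
  the split extensions is its zero element.
\<close>

definition extensions :: "('b, 'x) ring_scheme \<Rightarrow> ('b, 'm, 'y) module_scheme \<Rightarrow>
    ('b, 'n, 'z) module_scheme \<Rightarrow>
    ('b fgm \<times> ('n \<Rightarrow> (nat \<Rightarrow> 'b) set) \<times> ((nat \<Rightarrow> 'b) set \<Rightarrow> 'm)) set" where
  "extensions A M N = {(E, i, p). fg_module A E \<and> short_exact A N E M i p}"

definition extension_equiv :: "('b, 'x) ring_scheme \<Rightarrow> ('b, 'm, 'y) module_scheme \<Rightarrow>
    ('b, 'n, 'z) module_scheme \<Rightarrow>
    ('b fgm \<times> ('n \<Rightarrow> (nat \<Rightarrow> 'b) set) \<times> ((nat \<Rightarrow> 'b) set \<Rightarrow> 'm)) rel" where
  "extension_equiv A M N = {((E, i, p), (E', i', p')).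
     (E, i, p) \<in> extensions A M N \<and> (E', i', p') \<in> extensions A M N \<and>
     (\<exists>\<phi>\<in>mod_hom A E E'. (\<forall>x\<in>carrier N. \<phi> (i x) = i' x) \<and> (\<forall>y\<in>carrier E. p' (\<phi> y) = p y))}"

definition Ext1 :: "('b, 'x) ring_scheme \<Rightarrow> ('b, 'm, 'y) module_scheme \<Rightarrow>
    ('b, 'n, 'z) module_scheme \<Rightarrow>
    ('b fgm \<times> ('n \<Rightarrow> (nat \<Rightarrow> 'b) set) \<times> ((nat \<Rightarrow> 'b) set \<Rightarrow> 'm)) set set" where
  "Ext1 A M N = extensions A M N // extension_equiv A M N"

definition Ext1_zero :: "('b, 'x) ring_scheme \<Rightarrow> ('b, 'm, 'y) module_scheme \<Rightarrow>
    ('b, 'n, 'z) module_scheme \<Rightarrow>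
    ('b fgm \<times> ('n \<Rightarrow> (nat \<Rightarrow> 'b) set) \<times> ((nat \<Rightarrow> 'b) set \<Rightarrow> 'm)) set" where
  "Ext1_zero A M N = {(E, i, p). (E, i, p) \<in> extensions A M N \<and>
     (\<exists>\<sigma>\<in>mod_hom A M E. \<forall>x\<in>carrier M. p (\<sigma> x) = x)}"

definition add_closure :: "('b, 'x) ring_scheme \<Rightarrow> ('b, 'm) module \<Rightarrow> 'b fgm set" where
  "add_closure A T = {M. fg_module A M \<and>
     (\<exists>(N :: 'b fgm) n. fg_module A N \<and> mod_iso A (dsum2 M N) (mod_power T n))}"

definition tilting :: "('b, 'x) ring_scheme \<Rightarrow> ('b, 'm) module \<Rightarrow> bool" where
  "tilting A T \<longleftrightarrow> fg_module A T \<and> pd_le_1 A T \<and> Ext1 A T T = {Ext1_zero A T T} \<and>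
     (\<exists>T0\<in>add_closure A T. \<exists>T1\<in>add_closure A T. \<exists>i p. short_exact A (regular_module A) T0 T1 i p)"

definition Fac :: "('b, 'x) ring_scheme \<Rightarrow> ('b, 'm) module \<Rightarrow> 'b fgm set" where
  "Fac A T = {M. fg_module A M \<and> (\<exists>n. \<exists>p\<in>mod_hom A (mod_power T n) M.
     p ` carrier (mod_power T n) = carrier M)}"

definition tilting_le :: "('b, 'x) ring_scheme \<Rightarrow> ('b, 'm) module \<Rightarrow> ('b, 'n) module \<Rightarrow> bool" where
  "tilting_le A T T' \<longleftrightarrow> Fac A T \<subseteq> Fac A T'"

definition tilting_less :: "('b, 'x) ring_scheme \<Rightarrow> ('b, 'm) module \<Rightarrow> ('b, 'n) module \<Rightarrow> bool" where
  "tilting_less A T T' \<longleftrightarrow> tilting_le A T T' \<and> \<not> tilting_le A T' T"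


section \<open>Endomorphism algebras\<close>

text \<open>
  An \<open>R\<close>-algebra is a record \<^typ>\<open>('r, 'b) module\<close>, with all ring fields in use. The scalar \<open>r\<close> acts on
  an \<open>A\<close>-module through the central element \<open>r \<odot> \<one>\<close> of \<open>A\<close>.
\<close>

definition End_alg :: "('r, 'b, 'x) module_scheme \<Rightarrow> ('b, 'm, 'y) module_scheme \<Rightarrow> ('r, 'm \<Rightarrow> 'm) module"
  where
  "End_alg A M = \<lparr>carrier = mod_hom A M M \<inter> extensional (carrier M),
     monoid.mult = compose (carrier M),
     one = (\<lambda>x\<in>carrier M. x),
     ring.zero = (\<lambda>x\<in>carrier M. \<zero>\<^bsub>M\<^esub>),
     add = (\<lambda>f f'. \<lambda>x\<in>carrier M. f x \<oplus>\<^bsub>M\<^esub> f' x),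
     smult = (\<lambda>r f. \<lambda>x\<in>carrier M. (r \<odot>\<^bsub>A\<^esub> \<one>\<^bsub>A\<^esub>) \<odot>\<^bsub>M\<^esub> f x)\<rparr>"

definition op_alg :: "('r, 'b) module \<Rightarrow> ('r, 'b) module" where
  "op_alg A = A\<lparr>monoid.mult := (\<lambda>x y. y \<otimes>\<^bsub>A\<^esub> x)\<rparr>"

definition alg_iso :: "('r, 'x) ring_scheme \<Rightarrow> ('r, 'b) module \<Rightarrow> ('r, 'c) module \<Rightarrow> bool" where
  "alg_iso R A B \<longleftrightarrow>
     (\<exists>f\<in>ring_iso A B. \<forall>r\<in>carrier R. \<forall>x\<in>carrier A. f (r \<odot>\<^bsub>A\<^esub> x) = r \<odot>\<^bsub>B\<^esub> f x)"


section \<open>Local principal algebras and the algebras \<open>A\<^sub>h\<close>\<close>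

definition jacobson_radical :: "('a, 'x) ring_scheme \<Rightarrow> 'a set" where
  "jacobson_radical P = \<Inter>{I. maximalideal I P} \<inter> carrier P"

definition rad_power :: "('a, 'x) ring_scheme \<Rightarrow> nat \<Rightarrow> 'a set" where
  "rad_power P n = jacobson_radical P [^]\<^bsub>ideals_set P\<^esub> n"

definition loewy_length :: "('a, 'x) ring_scheme \<Rightarrow> nat" where
  "loewy_length P = (LEAST r. rad_power P r = {\<zero>\<^bsub>P\<^esub>})"

locale fd_local_principal_algebra = R?: field R + algebra R \<O>
  for R :: "('r, 'x) ring_scheme" (structure) and \<O> :: "('r, 'a) module" (structure) +
  assumes finite_dimensional: "fin_gen R \<O>"
    and local: "\<exists>!I. maximalideal I \<O>"
    and principal: "ideal I \<O> \<Longrightarrow> principalideal I \<O>"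

text \<open>Tuples \<open>h = (h\<^sub>1, \<dots>, h\<^sub>s)\<close> are functions on \<^typ>\<open>nat\<close> of which only the values on \<open>{1..s}\<close> matter.\<close>

definition partial_sum :: "(nat \<Rightarrow> nat) \<Rightarrow> nat \<Rightarrow> nat" where
  "partial_sum h i = (\<Sum>j = 1..i. h j)"

definition chain_module :: "('r, 'a) module \<Rightarrow> nat \<Rightarrow> (nat \<Rightarrow> nat) \<Rightarrow> ('a, nat \<Rightarrow> 'a set) module" where
  "chain_module \<O> s h = dsum {1..s} (\<lambda>i. quot_module \<O> (rad_power \<O> (partial_sum h i)))"

definition chain_alg :: "('r, 'a) module \<Rightarrow> nat \<Rightarrow> (nat \<Rightarrow> nat) \<Rightarrow>
    ('r, (nat \<Rightarrow> 'a set) \<Rightarrow> (nat \<Rightarrow> 'a set)) module" where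
  "chain_alg \<O> s h = End_alg \<O> (chain_module \<O> s h)"

definition chain_idem :: "('r, 'a) module \<Rightarrow> nat \<Rightarrow> (nat \<Rightarrow> nat) \<Rightarrow> nat \<Rightarrow>
    (nat \<Rightarrow> 'a set) \<Rightarrow> (nat \<Rightarrow> 'a set)" where
  "chain_idem \<O> s h i = (\<lambda>x\<in>carrier (chain_module \<O> s h). \<lambda>j\<in>{1..s}.
     if j = i then x j else \<zero>\<^bsub>quot_module \<O> (rad_power \<O> (partial_sum h j))\<^esub>)"


section \<open>Permutations\<close>

text \<open>
  \<open>\<Sigma>\<^sub>s\<close> is the library's \<^term>\<open>sym_group s\<close>, with product \<^term>\<open>(\<circ>)\<close>; the tuple \<open>g \<cdot> w\<close> with
  entries \<open>g\<^bsub>w(j)\<^esub>\<close> is then \<^term>\<open>g \<circ> w\<close>.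
\<close>

abbreviation Sym :: "nat \<Rightarrow> (nat \<Rightarrow> nat) set" where
  "Sym s \<equiv> carrier (sym_group s)"

definition simple_refl :: "nat \<Rightarrow> nat \<Rightarrow> nat" where
  "simple_refl i = transpose i (Suc i)"

definition coxeter_length :: "nat \<Rightarrow> (nat \<Rightarrow> nat) \<Rightarrow> nat" where
  "coxeter_length s w = (LEAST n. \<exists>is. length is = n \<and> set is \<subseteq> {1..<s} \<and>
     w = foldr (\<lambda>i v. simple_refl i \<circ> v) is id)"

definition level_set :: "nat \<Rightarrow> (nat \<Rightarrow> nat) \<Rightarrow> nat \<Rightarrow> nat set" where
  "level_set s g a = {j \<in> {1..s}. g j = a}"

definition stab :: "nat \<Rightarrow> (nat \<Rightarrow> nat) \<Rightarrow> (nat \<Rightarrow> nat) set" where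
  "stab s g = {h \<in> Sym s. \<forall>j\<in>{1..s}. (g \<circ> h) j = g j}"

definition is_interval :: "nat set \<Rightarrow> bool" where
  "is_interval I \<longleftrightarrow> (\<exists>m n. I = {m..n})"


section \<open>The family of basic tilting modules\<close>

definition tilt :: "nat \<Rightarrow> ((nat \<Rightarrow> nat) \<Rightarrow> nat \<Rightarrow> ('b, 'm) module) \<Rightarrow> (nat \<Rightarrow> nat) \<Rightarrow>
    ('b, nat \<Rightarrow> 'm) module" where
  "tilt s T w = dsum {1..s} (T w)"

definition end_op :: "('r, 'a) module \<Rightarrow> nat \<Rightarrow> (nat \<Rightarrow> nat) \<Rightarrow>
    ((nat \<Rightarrow> 'a set) \<Rightarrow> (nat \<Rightarrow> 'a set), 'm) module \<Rightarrow> ('r, 'm \<Rightarrow> 'm) module" where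
  "end_op \<O> s g M = op_alg (End_alg (chain_alg \<O> s g) M)"

text \<open>
  \<open>T w j\<close> is the summand of \<open>T\<^sub>w\<close> with label \<open>j\<close>. Such a family is determined only up to isomorphism,
  so equality of modules is read as isomorphism.
\<close>

locale tilting_family =
  fixes R :: "('r, 'x) ring_scheme"
    and \<O> :: "('r, 'a) module"
    and s :: nat
    and g :: "nat \<Rightarrow> nat"
    and T :: "(nat \<Rightarrow> nat) \<Rightarrow> nat \<Rightarrow> ((nat \<Rightarrow> 'a set) \<Rightarrow> (nat \<Rightarrow> 'a set), 'm) module"
  assumes indecomposable_summands:
      "\<lbrakk>w \<in> Sym s; j \<in> {1..s}\<rbrakk> \<Longrightarrow> indecomposable (chain_alg \<O> s g) (T w j)"
    and basic: "w \<in> Sym s \<Longrightarrow> basic_module (chain_alg \<O> s g) (tilt s T w)"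
    and tilting: "w \<in> Sym s \<Longrightarrow> tilting (chain_alg \<O> s g) (tilt s T w)"
    and irredundant:
      "\<lbrakk>w \<in> Sym s; w' \<in> Sym s; mod_iso (chain_alg \<O> s g) (tilt s T w) (tilt s T w')\<rbrakk> \<Longrightarrow> w = w'"
    and complete:
      "\<And>M :: ((nat \<Rightarrow> 'a set) \<Rightarrow> (nat \<Rightarrow> 'a set)) fgm.
         \<lbrakk>basic_module (chain_alg \<O> s g) M; tilting (chain_alg \<O> s g) M\<rbrakk> \<Longrightarrow>
         \<exists>w\<in>Sym s. mod_iso (chain_alg \<O> s g) M (tilt s T w)"
    and base: "mod_iso (chain_alg \<O> s g) (tilt s T id) (regular_module (chain_alg \<O> s g))"
    and base_summands: "j \<in> {1..s} \<Longrightarrow> mod_iso (chain_alg \<O> s g) (T id j)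
         (left_ideal_module (chain_alg \<O> s g) (chain_idem \<O> s g j))"
    and end_op_tilt: "w \<in> Sym s \<Longrightarrow>
         alg_iso R (end_op \<O> s g (tilt s T w)) (chain_alg \<O> s (g \<circ> w))"
    and mutation_summands:
      "\<lbrakk>w \<in> Sym s; i \<in> {1..<s}; coxeter_length s (w \<circ> simple_refl i) = coxeter_length s w + 1;
        j \<in> {1..s}; j \<noteq> i\<rbrakk> \<Longrightarrow>
        mod_iso (chain_alg \<O> s g) (T (w \<circ> simple_refl i) j) (T w j)"
    and mutation_less:
      "\<lbrakk>w \<in> Sym s; i \<in> {1..<s}; coxeter_length s (w \<circ> simple_refl i) = coxeter_length s w + 1\<rbrakk> \<Longrightarrow>
        tilting_less (chain_alg \<O> s g) (tilt s T (w \<circ> simple_refl i)) (tilt s T w)"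


section \<open>Labeled multigraphs, the mutation graph and the Schreier graph\<close>

text \<open>The ends of an undirected edge form a set, which is a singleton exactly for a loop.\<close>

record ('v, 'e) lgraph =
  lverts :: "'v set"
  ledges :: "'e set"
  lends :: "'e \<Rightarrow> 'v set"
  llabel :: "'e \<Rightarrow> nat"

definition is_loop :: "('v, 'e) lgraph \<Rightarrow> 'e \<Rightarrow> bool" where
  "is_loop \<Gamma> e \<longleftrightarrow> card (lends \<Gamma> e) = 1"

definition lgraph_iso :: "('v, 'e) lgraph \<Rightarrow> ('u, 'd) lgraph \<Rightarrow> ('v \<Rightarrow> 'u) \<Rightarrow> ('e \<Rightarrow> 'd) \<Rightarrow> bool" where
  "lgraph_iso \<Gamma> \<Delta> \<alpha> \<beta> \<longleftrightarrow>
     bij_betw \<alpha> (lverts \<Gamma>) (lverts \<Delta>) \<and> bij_betw \<beta> (ledges \<Gamma>) (ledges \<Delta>) \<and>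
     (\<forall>e\<in>ledges \<Gamma>. lends \<Delta> (\<beta> e) = \<alpha> ` lends \<Gamma> e \<and> llabel \<Delta> (\<beta> e) = llabel \<Gamma> e)"

text \<open>The quotient by a group \<open>K\<close> acting by \<open>\<phi>\<close> on vertices and by \<open>\<psi>\<close> on edges, preserving labels.\<close>

definition quotient_lgraph :: "('h, 'x) monoid_scheme \<Rightarrow> ('h \<Rightarrow> 'v \<Rightarrow> 'v) \<Rightarrow> ('h \<Rightarrow> 'e \<Rightarrow> 'e) \<Rightarrow>
    ('v, 'e) lgraph \<Rightarrow> ('v set, 'e set) lgraph" where
  "quotient_lgraph K \<phi> \<psi> \<Gamma> = \<lparr>
     lverts = orbits K (lverts \<Gamma>) \<phi>,
     ledges = orbits K (ledges \<Gamma>) \<psi>,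
     lends = (\<lambda>\<epsilon>. {orbit K \<phi> x | x e. e \<in> \<epsilon> \<and> x \<in> lends \<Gamma> e}),
     llabel = (\<lambda>\<epsilon>. the_elem (llabel \<Gamma> ` \<epsilon>))\<rparr>"

definition mutation_edge :: "nat \<Rightarrow> ((nat \<Rightarrow> nat) \<Rightarrow> nat \<Rightarrow> ('b, 'm) module) \<Rightarrow> nat \<Rightarrow> (nat \<Rightarrow> nat) \<Rightarrow>
    nat \<times> ('b, nat \<Rightarrow> 'm) module set" where
  "mutation_edge s T i w = (i, {tilt s T w, tilt s T (w \<circ> simple_refl i)})"

definition mutation_graph :: "nat \<Rightarrow> ((nat \<Rightarrow> nat) \<Rightarrow> nat \<Rightarrow> ('b, 'm) module) \<Rightarrow>
    (('b, nat \<Rightarrow> 'm) module, nat \<times> ('b, nat \<Rightarrow> 'm) module set) lgraph" where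
  "mutation_graph s T = \<lparr>
     lverts = tilt s T ` Sym s,
     ledges = {mutation_edge s T i w | i w. i \<in> {1..<s} \<and> w \<in> Sym s},
     lends = snd,
     llabel = fst\<rparr>"

text \<open>The action of \<open>h\<close> sends \<open>T\<^sub>w\<close> to \<open>T\<^sub>h\<^sub>w\<close>; the map \<open>w \<mapsto> T\<^sub>w\<close> is injective on \<open>\<Sigma>\<^sub>s\<close>.\<close>

definition vertex_act :: "nat \<Rightarrow> ((nat \<Rightarrow> nat) \<Rightarrow> nat \<Rightarrow> ('b, 'm) module) \<Rightarrow> (nat \<Rightarrow> nat) \<Rightarrow>
    ('b, nat \<Rightarrow> 'm) module \<Rightarrow> ('b, nat \<Rightarrow> 'm) module" where
  "vertex_act s T h M = tilt s T (h \<circ> inv_into (Sym s) (tilt s T) M)"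

definition edge_act :: "nat \<Rightarrow> ((nat \<Rightarrow> nat) \<Rightarrow> nat \<Rightarrow> ('b, 'm) module) \<Rightarrow> (nat \<Rightarrow> nat) \<Rightarrow>
    nat \<times> ('b, nat \<Rightarrow> 'm) module set \<Rightarrow> nat \<times> ('b, nat \<Rightarrow> 'm) module set" where
  "edge_act s T h e = (fst e, vertex_act s T h ` snd e)"

abbreviation stab_group :: "nat \<Rightarrow> (nat \<Rightarrow> nat) \<Rightarrow> (nat \<Rightarrow> nat) monoid" where
  "stab_group s g \<equiv> (sym_group s)\<lparr>carrier := stab s g\<rparr>"

definition mutation_quotient :: "nat \<Rightarrow> (nat \<Rightarrow> nat) \<Rightarrow> ((nat \<Rightarrow> nat) \<Rightarrow> nat \<Rightarrow> ('b, 'm) module) \<Rightarrow>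
    (('b, nat \<Rightarrow> 'm) module set, (nat \<times> ('b, nat \<Rightarrow> 'm) module set) set) lgraph" where
  "mutation_quotient s g T =
     quotient_lgraph (stab_group s g) (vertex_act s T) (edge_act s T) (mutation_graph s T)"

definition schreier_graph :: "nat \<Rightarrow> (nat \<Rightarrow> nat) set \<Rightarrow>
    ((nat \<Rightarrow> nat) set, nat \<times> (nat \<Rightarrow> nat) set set) lgraph" where
  "schreier_graph s H = \<lparr>
     lverts = rcosets\<^bsub>sym_group s\<^esub> H,
     ledges = {(i, {((\<lambda>Y. Y #>\<^bsub>sym_group s\<^esub> simple_refl i) ^^ n) X | n. True}) | i X.
        i \<in> {1..<s} \<and> X \<in> rcosets\<^bsub>sym_group s\<^esub> H},
     lends = snd,
     llabel = fst\<rparr>"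

definition end_op_rel :: "('r, 'x) ring_scheme \<Rightarrow> ('r, 'a) module \<Rightarrow> nat \<Rightarrow> (nat \<Rightarrow> nat) \<Rightarrow>
    ((nat \<Rightarrow> nat) \<Rightarrow> nat \<Rightarrow> ((nat \<Rightarrow> 'a set) \<Rightarrow> (nat \<Rightarrow> 'a set), 'm) module) \<Rightarrow>
    ((nat \<Rightarrow> 'a set) \<Rightarrow> (nat \<Rightarrow> 'a set), nat \<Rightarrow> 'm) module rel" where
  "end_op_rel R \<O> s g T = {(M, N). M \<in> lverts (mutation_graph s T) \<and> N \<in> lverts (mutation_graph s T) \<and>
     alg_iso R (end_op \<O> s g M) (end_op \<O> s g N)}"

text \<open>The right weak order, as the set of arcs \<open>T\<^sub>w \<rightarrow> T\<^sub>w\<^sub>s\<^sub>i\<close> with label \<open>i\<close>.\<close>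

definition weak_order_arcs :: "nat \<Rightarrow> ((nat \<Rightarrow> nat) \<Rightarrow> nat \<Rightarrow> ('b, 'm) module) \<Rightarrow>
    (('b, nat \<Rightarrow> 'm) module \<times> nat \<times> ('b, nat \<Rightarrow> 'm) module) set" where
  "weak_order_arcs s T = {(tilt s T w, i, tilt s T (w \<circ> simple_refl i)) | w i.
     w \<in> Sym s \<and> i \<in> {1..<s} \<and> coxeter_length s (w \<circ> simple_refl i) = coxeter_length s w + 1}"

definition orientation_descends ::
    "nat \<Rightarrow> (nat \<Rightarrow> nat) \<Rightarrow> ((nat \<Rightarrow> nat) \<Rightarrow> nat \<Rightarrow> ('b, 'm) module) \<Rightarrow> bool" where
  "orientation_descends s g T \<longleftrightarrow> (\<forall>w\<in>Sym s. \<forall>i\<in>{1..<s}.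
     \<not> is_loop (mutation_quotient s g T)
         (orbit (stab_group s g) (edge_act s T) (mutation_edge s T i w)) \<longrightarrow>
     (\<forall>h\<in>stab s g.
        (tilt s T (h \<circ> w), i, tilt s T (h \<circ> w \<circ> simple_refl i)) \<in> weak_order_arcs s T) \<or>
     (\<forall>h\<in>stab s g.
        (tilt s T (h \<circ> w \<circ> simple_refl i), i, tilt s T (h \<circ> w)) \<in> weak_order_arcs s T))"

end

theory Submission
  imports Defs "HOL-Algebra.Embedded_Algebras" "HOL-Algebra.Ring_Divisibility"
begin

text \<open>
  Since \<open>End(T\<^sub>w)\<^sup>o\<^sup>p\<close> is isomorphic to \<open>A\<^bsub>g\<cdot>w\<^esub>\<close>, the first claim amounts to recovering \<open>h\<close> from the algebra
  \<open>A\<^sub>h = End(\<Oplus>\<^sub>i \<O>/p\<^bsup>q\<^sub>i\<^esup>)\<close>, where \<open>p\<close> generates the radical of \<open>\<O>\<close>. The centre of \<open>A\<^sub>h\<close> is \<open>\<O>\<close>, so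
  its central nilpotent elements are the multiples of \<open>p\<close>. A number \<open>k > 0\<close> is one of the \<open>q\<^sub>i\<close> iff
  some idempotent \<open>x\<close> satisfies \<open>p\<^sup>k x = 0 \<noteq> p\<^bsup>k-1\<^esup> x\<close>: the projection onto the \<open>i\<close>th summand is such an
  idempotent for \<open>k = q\<^sub>i\<close>. Conversely, if \<open>k\<close> is none of the \<open>q\<^sub>i\<close>, every element \<open>y = x m\<close> of the image
  of \<open>x\<close> is killed by \<open>p\<^sup>k\<close>, hence \<open>p\<^bsup>k-1\<^esup> y = p\<^sup>k t\<close> for some \<open>t\<close>, and \<open>p\<^bsup>k-1\<^esup> y = x p\<^sup>k t = p\<^sup>k x t = 0\<close>.

  The edge of \<open>T\<^sub>w\<close> with label \<open>i\<close> points away from \<open>w\<close> iff \<open>w(i) < w(i+1)\<close>, so the orientation descends iff \<open>H\<^sub>g\<close>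
  preserves the order of any two elements from different level sets of \<open>g\<close>. If some \<open>a < b < c\<close> have
  \<open>g\<^sub>a = g\<^sub>c \<noteq> g\<^sub>b\<close>, the transposition \<open>(a, c)\<close> violates this.
\<close>

section \<open>Endomorphism algebras\<close>

lemma (in lmodule) smult_zero_right:
  assumes "a \<in> carrier A"
  shows "a \<odot>\<^bsub>M\<^esub> \<zero>\<^bsub>M\<^esub> = \<zero>\<^bsub>M\<^esub>"
proof -
  have "a \<odot>\<^bsub>M\<^esub> \<zero>\<^bsub>M\<^esub> \<oplus>\<^bsub>M\<^esub> a \<odot>\<^bsub>M\<^esub> \<zero>\<^bsub>M\<^esub> = a \<odot>\<^bsub>M\<^esub> \<zero>\<^bsub>M\<^esub>"
    using smult_r_distr[OF assms M.zero_closed M.zero_closed] by simp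
  then show ?thesis
    using smult_closed[OF assms M.zero_closed] by (metis M.add.r_cancel_one')
qed

lemma (in lmodule) smult_minus_right:
  assumes "a \<in> carrier A" "x \<in> carrier M"
  shows "a \<odot>\<^bsub>M\<^esub> (\<ominus>\<^bsub>M\<^esub> x) = \<ominus>\<^bsub>M\<^esub> (a \<odot>\<^bsub>M\<^esub> x)"
proof -
  have "a \<odot>\<^bsub>M\<^esub> (\<ominus>\<^bsub>M\<^esub> x) \<oplus>\<^bsub>M\<^esub> a \<odot>\<^bsub>M\<^esub> x = \<zero>\<^bsub>M\<^esub>"
    using assms smult_r_distr[of a "\<ominus>\<^bsub>M\<^esub> x" x] by (simp add: M.l_neg smult_zero_right)
  then show ?thesis
    using assms by (intro M.minus_equality[symmetric]) (auto simp: smult_closed)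
qed

lemma End_algI:
  assumes "\<And>x. x \<in> carrier M \<Longrightarrow> f x \<in> carrier M"
    and "\<And>x y. x \<in> carrier M \<Longrightarrow> y \<in> carrier M \<Longrightarrow> f (x \<oplus>\<^bsub>M\<^esub> y) = f x \<oplus>\<^bsub>M\<^esub> f y"
    and "\<And>a x. a \<in> carrier A \<Longrightarrow> x \<in> carrier M \<Longrightarrow> f (a \<odot>\<^bsub>M\<^esub> x) = a \<odot>\<^bsub>M\<^esub> f x"
    and "f \<in> extensional (carrier M)"
  shows "f \<in> carrier (End_alg A M)"
  using assms by (auto simp: End_alg_def mod_hom_def)

lemma End_algD:
  assumes "f \<in> carrier (End_alg A M)"
  shows "x \<in> carrier M \<Longrightarrow> f x \<in> carrier M"
    and "x \<in> carrier M \<Longrightarrow> y \<in> carrier M \<Longrightarrow> f (x \<oplus>\<^bsub>M\<^esub> y) = f x \<oplus>\<^bsub>M\<^esub> f y"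
    and "a \<in> carrier A \<Longrightarrow> x \<in> carrier M \<Longrightarrow> f (a \<odot>\<^bsub>M\<^esub> x) = a \<odot>\<^bsub>M\<^esub> f x"
    and "f \<in> extensional (carrier M)"
  using assms by (auto simp: End_alg_def mod_hom_def)

lemma End_alg_sel:
  "monoid.mult (End_alg A M) = compose (carrier M)"
  "\<one>\<^bsub>End_alg A M\<^esub> = (\<lambda>x\<in>carrier M. x)"
  "\<zero>\<^bsub>End_alg A M\<^esub> = (\<lambda>x\<in>carrier M. \<zero>\<^bsub>M\<^esub>)"
  "add (End_alg A M) = (\<lambda>f f'. \<lambda>x\<in>carrier M. f x \<oplus>\<^bsub>M\<^esub> f' x)"
  "smult (End_alg A M) = (\<lambda>r f. \<lambda>x\<in>carrier M. (r \<odot>\<^bsub>A\<^esub> \<one>\<^bsub>A\<^esub>) \<odot>\<^bsub>M\<^esub> f x)"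
  by (simp_all add: End_alg_def)

lemma End_alg_eqI:
  assumes "f \<in> carrier (End_alg A M)" "f' \<in> carrier (End_alg A M)"
    and "\<And>x. x \<in> carrier M \<Longrightarrow> f x = f' x"
  shows "f = f'"
  using End_algD(4)[OF assms(1)] End_algD(4)[OF assms(2)] assms(3) by (rule extensionalityI)

text \<open>Stated over arbitrary rings of scalars because it serves twice: for \<open>\<O>\<close>
  acting on the chain module and for the chain algebra acting on tilting modules.\<close>

lemma End_alg_ring:
  fixes A :: "('r, 'b, 'x) module_scheme" and M :: "('b, 'm, 'y) module_scheme"
  assumes "lmodule A M"
  shows "ring (End_alg A M)"
proof -
  interpret lmodule A M by (rule assms)
  let ?E = "End_alg A M"
  note cl = End_algD[of _ A M]
  have zero: "(\<lambda>x\<in>carrier M. \<zero>\<^bsub>M\<^esub>) \<in> carrier ?E"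
    by (rule End_algI) (auto simp: smult_zero_right smult_closed)
  have plus: "(\<lambda>x\<in>carrier M. f x \<oplus>\<^bsub>M\<^esub> f' x) \<in> carrier ?E"
    if "f \<in> carrier ?E" "f' \<in> carrier ?E" for f f'
    using cl[OF that(1)] cl[OF that(2)]
    by (intro End_algI) (auto simp: smult_closed smult_r_distr M.a_ac)
  have neg: "(\<lambda>x\<in>carrier M. \<ominus>\<^bsub>M\<^esub> f x) \<in> carrier ?E" if "f \<in> carrier ?E" for f
    using cl[OF that]
    by (intro End_algI) (auto simp: smult_closed smult_minus_right M.minus_add M.a_comm)
  have one: "(\<lambda>x\<in>carrier M. x) \<in> carrier ?E"
    by (rule End_algI) (auto simp: smult_closed)
  have comp: "compose (carrier M) f f' \<in> carrier ?E"
    if "f \<in> carrier ?E" "f' \<in> carrier ?E" for f f'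
    using cl[OF that(1)] cl[OF that(2)]
    by (intro End_algI) (auto simp: compose_def smult_closed)
  show ?thesis
  proof (rule ringI)
    show "abelian_group ?E"
    proof (rule abelian_groupI)
      fix f assume f: "f \<in> carrier ?E"
      show "\<exists>f'\<in>carrier ?E. f' \<oplus>\<^bsub>?E\<^esub> f = \<zero>\<^bsub>?E\<^esub>"
        using neg[OF f] cl(1)[OF f]
        by (intro bexI[of _ "\<lambda>x\<in>carrier M. \<ominus>\<^bsub>M\<^esub> f x"]) (auto simp: End_alg_sel M.l_neg)
      show "\<zero>\<^bsub>?E\<^esub> \<oplus>\<^bsub>?E\<^esub> f = f"
        using plus[OF zero f] f cl(1)[OF f] by (intro End_alg_eqI) (auto simp: End_alg_sel)
    qed (use zero plus cl in \<open>auto simp: End_alg_sel M.a_ac\<close>)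
    show "monoid ?E"
    proof (rule monoidI)
      fix f assume f: "f \<in> carrier ?E"
      show "\<one>\<^bsub>?E\<^esub> \<otimes>\<^bsub>?E\<^esub> f = f"
        using comp[OF one f] f cl(1)[OF f] by (intro End_alg_eqI) (auto simp: End_alg_sel compose_def)
      show "f \<otimes>\<^bsub>?E\<^esub> \<one>\<^bsub>?E\<^esub> = f"
        using comp[OF f one] f cl(1)[OF f] by (intro End_alg_eqI) (auto simp: End_alg_sel compose_def)
    qed (use one comp cl in \<open>auto simp: End_alg_sel compose_def\<close>)
  qed (use plus comp cl in \<open>auto simp: End_alg_sel compose_def\<close>)
qed

section \<open>Opposite algebras and isomorphism of algebras\<close>

lemma op_alg_sel [simp]:
  "carrier (op_alg B) = carrier B" "\<one>\<^bsub>op_alg B\<^esub> = \<one>\<^bsub>B\<^esub>" "\<zero>\<^bsub>op_alg B\<^esub> = \<zero>\<^bsub>B\<^esub>"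
  "add (op_alg B) = add B" "smult (op_alg B) = smult B"
  "x \<otimes>\<^bsub>op_alg B\<^esub> y = y \<otimes>\<^bsub>B\<^esub> x"
  by (simp_all add: op_alg_def)

lemma op_alg_ring:
  assumes "ring B"
  shows "ring (op_alg B)"
proof -
  interpret ring B by (rule assms)
  show ?thesis
  proof (rule ringI)
    show "abelian_group (op_alg B)"
      by (rule abelian_groupI) (auto simp: a_ac intro: l_neg)
    show "monoid (op_alg B)"
      by (rule monoidI) (auto simp: m_assoc)
  qed (auto simp: l_distr r_distr)
qed

lemma alg_iso_trans:
  assumes "alg_iso R B C" "alg_iso R C D"
  shows "alg_iso R B D"
proof -
  obtain f where f: "f \<in> ring_iso B C"
      "\<And>r x. r \<in> carrier R \<Longrightarrow> x \<in> carrier B \<Longrightarrow> f (r \<odot>\<^bsub>B\<^esub> x) = r \<odot>\<^bsub>C\<^esub> f x"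
    using assms(1) unfolding alg_iso_def by blast
  obtain f' where f': "f' \<in> ring_iso C D"
      "\<And>r x. r \<in> carrier R \<Longrightarrow> x \<in> carrier C \<Longrightarrow> f' (r \<odot>\<^bsub>C\<^esub> x) = r \<odot>\<^bsub>D\<^esub> f' x"
    using assms(2) unfolding alg_iso_def by blast
  have "(f' \<circ> f) (r \<odot>\<^bsub>B\<^esub> x) = r \<odot>\<^bsub>D\<^esub> (f' \<circ> f) x" if "r \<in> carrier R" "x \<in> carrier B" for r x
    using that ring_iso_memE(1)[OF f(1) that(2)] by (simp only: comp_apply f(2) f'(2))
  then show ?thesis
    unfolding alg_iso_def using ring_iso_set_trans[OF f(1) f'(1)] by blast
qed

text \<open>\<open>alg_iso\<close> relates bare records, so closure under scalars is an explicit
  hypothesis: the inverse is linear because the scalar multiple stays in the set on which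
  \<open>f\<close> is injective.\<close>

lemma alg_iso_sym:
  assumes "alg_iso R B C" "ring B"
    and smult: "\<And>r x. r \<in> carrier R \<Longrightarrow> x \<in> carrier B \<Longrightarrow> r \<odot>\<^bsub>B\<^esub> x \<in> carrier B"
  shows "alg_iso R C B"
proof -
  obtain f where f: "f \<in> ring_iso B C"
      "\<And>r x. r \<in> carrier R \<Longrightarrow> x \<in> carrier B \<Longrightarrow> f (r \<odot>\<^bsub>B\<^esub> x) = r \<odot>\<^bsub>C\<^esub> f x"
    using assms(1) unfolding alg_iso_def by blast
  have bij: "bij_betw f (carrier B) (carrier C)"
    using ring_iso_memE(5)[OF f(1)] .
  have "inv_into (carrier B) f (r \<odot>\<^bsub>C\<^esub> y) = r \<odot>\<^bsub>B\<^esub> inv_into (carrier B) f y"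
    if r: "r \<in> carrier R" and y: "y \<in> carrier C" for r y
  proof (rule inv_into_f_eq)
    have x: "inv_into (carrier B) f y \<in> carrier B" "f (inv_into (carrier B) f y) = y"
      using bij_betw_imp_surj_on[OF bij] y by (simp_all add: inv_into_into f_inv_into_f)
    show "inj_on f (carrier B)"
      using bij by (rule bij_betw_imp_inj_on)
    show "r \<odot>\<^bsub>B\<^esub> inv_into (carrier B) f y \<in> carrier B"
      by (rule smult[OF r x(1)])
    show "f (r \<odot>\<^bsub>B\<^esub> inv_into (carrier B) f y) = r \<odot>\<^bsub>C\<^esub> y"
      unfolding f(2)[OF r x(1)] x(2) ..
  qed
  then show ?thesis
    unfolding alg_iso_def using ring_iso_set_sym[OF assms(2) f(1)] by blast
qed

section \<open>Direct sums of cyclic modules\<close>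

text \<open>The chain module with arbitrary ideals in place of powers of the radical; the module
  axioms use no more than that each \<open>I i\<close> is an ideal.\<close>

locale quotient_sum = cring P
  for P :: "('r, 'a) module" (structure) +
  fixes s :: nat and I :: "nat \<Rightarrow> 'a set"
  assumes ideals: "i \<in> {1..s} \<Longrightarrow> ideal (I i) P"
begin

lemma zero_in_I: "i \<in> {1..s} \<Longrightarrow> \<zero> \<in> I i"
  by (rule additive_subgroup.zero_closed[OF ideal.axioms(1)[OF ideals]])

lemma coset_zero:
  assumes "i \<in> {1..s}"
  shows "I i +> \<zero> = I i"
  by (rule a_rcos_zero[OF ideals[OF assms] zero_in_I[OF assms]])

definition qsum :: "('a, nat \<Rightarrow> 'a set) module" where
  "qsum = dsum {1..s} (\<lambda>i. quot_module P (I i))"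

text \<open>Tuples of cosets are handled through tuples of representatives, which turns the module
  operations into pointwise ring operations.\<close>

definition cls :: "(nat \<Rightarrow> 'a) \<Rightarrow> nat \<Rightarrow> 'a set" where
  "cls r = (\<lambda>i\<in>{1..s}. I i +> r i)"

lemma cls_cong: "(\<And>i. i \<in> {1..s} \<Longrightarrow> r i = r' i) \<Longrightarrow> cls r = cls r'"
  unfolding cls_def by (rule restrict_ext) simp

lemma cls_eq_iff:
  assumes "\<And>i. i \<in> {1..s} \<Longrightarrow> r i \<in> carrier P" "\<And>i. i \<in> {1..s} \<Longrightarrow> r' i \<in> carrier P"
  shows "cls r = cls r' \<longleftrightarrow> (\<forall>i\<in>{1..s}. r i \<ominus> r' i \<in> I i)"
proof -
  have "cls r = cls r' \<longleftrightarrow> (\<forall>i\<in>{1..s}. I i +> r i = I i +> r' i)"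
    by (auto simp: cls_def restrict_def fun_eq_iff)
  then show ?thesis
    using assms quotient_eq_iff_same_a_r_cos[OF ideals] by simp
qed

lemma carrier_qsum: "carrier qsum = cls ` ({1..s} \<rightarrow> carrier P)"
proof
  show "carrier qsum \<subseteq> cls ` ({1..s} \<rightarrow> carrier P)"
  proof
    fix x assume x: "x \<in> carrier qsum"
    have "\<forall>i\<in>{1..s}. \<exists>r. r \<in> carrier P \<and> x i = I i +> r"
      using x by (auto simp: qsum_def dsum_def quot_module_def FactRing_simps PiE_def Pi_def)
    then obtain r where r: "\<And>i. i \<in> {1..s} \<Longrightarrow> r i \<in> carrier P \<and> x i = I i +> r i"
      by metis
    have "x = cls r"
      using x r by (auto simp: cls_def qsum_def dsum_def PiE_def extensional_def restrict_def fun_eq_iff)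
    then show "x \<in> cls ` ({1..s} \<rightarrow> carrier P)"
      using r by auto
  qed
  show "cls ` ({1..s} \<rightarrow> carrier P) \<subseteq> carrier qsum"
    by (auto simp: cls_def qsum_def dsum_def quot_module_def FactRing_simps)
qed

lemma cls_closed: "(\<And>i. i \<in> {1..s} \<Longrightarrow> r i \<in> carrier P) \<Longrightarrow> cls r \<in> carrier qsum"
  by (auto simp: carrier_qsum)

lemma qsumE:
  assumes "x \<in> carrier qsum"
  obtains r where "\<And>i. r i \<in> carrier P" "x = cls r"
proof -
  obtain r where r: "r \<in> {1..s} \<rightarrow> carrier P" "x = cls r"
    using assms by (auto simp: carrier_qsum)
  \<comment> \<open>Setting the representative to zero outside \<open>{1..s}\<close> makes
    \<open>r i \<in> carrier P\<close> hold without a condition on \<open>i\<close>.\<close>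
  have "x = cls (\<lambda>i. if i \<in> {1..s} then r i else \<zero>)"
    using r(2) by (auto intro: cls_cong)
  then show thesis
    using r(1) by (intro that[of "\<lambda>i. if i \<in> {1..s} then r i else \<zero>"]) auto
qed

lemma cls_add:
  assumes "\<And>i. i \<in> {1..s} \<Longrightarrow> r i \<in> carrier P" "\<And>i. i \<in> {1..s} \<Longrightarrow> r' i \<in> carrier P"
  shows "cls r \<oplus>\<^bsub>qsum\<^esub> cls r' = cls (\<lambda>i. r i \<oplus> r' i)"
  using assms ideal.a_rcos_sum[OF ideals]
  by (auto simp: qsum_def dsum_def cls_def quot_module_def FactRing_def restrict_def fun_eq_iff)

lemma cls_smult:
  assumes "a \<in> carrier P" "\<And>i. i \<in> {1..s} \<Longrightarrow> r i \<in> carrier P"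
  shows "a \<odot>\<^bsub>qsum\<^esub> cls r = cls (\<lambda>i. a \<otimes> r i)"
  using assms ideal.rcoset_mult_add[OF ideals]
  by (auto simp: qsum_def dsum_def cls_def quot_module_def FactRing_def restrict_def fun_eq_iff)

lemma zero_qsum: "\<zero>\<^bsub>qsum\<^esub> = cls (\<lambda>i. \<zero>)"
  using coset_zero
  by (auto simp: qsum_def dsum_def cls_def quot_module_def FactRing_def restrict_def fun_eq_iff)

lemma lmodule_qsum: "lmodule P qsum"
proof -
  have "abelian_group qsum"
  proof (rule abelian_groupI)
    fix x assume "x \<in> carrier qsum"
    then obtain r where r: "\<And>i. r i \<in> carrier P" "x = cls r" by (rule qsumE) blast
    have "cls (\<lambda>i. \<ominus> r i) \<oplus>\<^bsub>qsum\<^esub> x = \<zero>\<^bsub>qsum\<^esub>"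
      using r by (simp add: cls_add zero_qsum l_neg)
    then show "\<exists>y\<in>carrier qsum. y \<oplus>\<^bsub>qsum\<^esub> x = \<zero>\<^bsub>qsum\<^esub>"
      using r by (intro bexI[of _ "cls (\<lambda>i. \<ominus> r i)"]) (auto intro: cls_closed)
  qed (auto elim!: qsumE simp: cls_add zero_qsum a_ac intro!: cls_closed)
  moreover have "lmodule_axioms P qsum"
    by unfold_locales
      (auto elim!: qsumE simp: cls_add cls_smult l_distr r_distr m_assoc intro!: cls_closed)
  ultimately show ?thesis
    by (intro lmodule.intro ring_axioms)
qed

end

section \<open>Idempotents and central nilpotent elements\<close>

text \<open>The nilradical of the centre, described by ring operations alone so that ring
  isomorphisms preserve it.\<close>

definition central_nilpotents :: "('b, 'x) ring_scheme \<Rightarrow> 'b set" where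
  "central_nilpotents A = {z \<in> carrier A. (\<forall>x\<in>carrier A. z \<otimes>\<^bsub>A\<^esub> x = x \<otimes>\<^bsub>A\<^esub> z) \<and>
     (\<exists>m::nat. z [^]\<^bsub>A\<^esub> m = \<zero>\<^bsub>A\<^esub>)}"

text \<open>For \<open>A = End (\<Oplus>\<^sub>i P/p\<^bsup>q\<^sub>i\<^esup>)\<close> over a uniserial ring \<open>P\<close>, the levels turn out to be the exponents
  \<open>q\<^sub>i\<close>; no theorem on the uniqueness of direct sum decompositions is needed.\<close>

definition idempotent_levels :: "('b, 'x) ring_scheme \<Rightarrow> nat set" where
  "idempotent_levels A = {k. \<exists>x\<in>carrier A. x \<otimes>\<^bsub>A\<^esub> x = x \<and>
     (\<forall>z\<in>central_nilpotents A. z [^]\<^bsub>A\<^esub> k \<otimes>\<^bsub>A\<^esub> x = \<zero>\<^bsub>A\<^esub>) \<and>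
     (\<exists>z\<in>central_nilpotents A. z [^]\<^bsub>A\<^esub> (k - 1) \<otimes>\<^bsub>A\<^esub> x \<noteq> \<zero>\<^bsub>A\<^esub>)}"

text \<open>Levels are built from multiplication, powers and zero, all of which a ring isomorphism
  carries over. One inclusion is enough, since the inverse isomorphism gives the other.\<close>

lemma idempotent_levels_mono:
  assumes f: "f \<in> ring_iso A B" and "ring A" "ring B"
  shows "idempotent_levels A \<subseteq> idempotent_levels B"
proof
  interpret A: ring A by (rule assms)
  interpret B: ring B by (rule assms)
  interpret f: ring_hom_ring A B f
    using f by (intro ring_hom_ringI2 assms) (simp add: ring_iso_def)
  have bij: "bij_betw f (carrier A) (carrier B)" using ring_iso_memE(5)[OF f] .
  have inj: "f x = f y \<longleftrightarrow> x = y" if "x \<in> carrier A" "y \<in> carrier A" for x y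
    using bij_betw_imp_inj_on[OF bij] that by (rule inj_on_eq_iff)
  have surj: "\<exists>x\<in>carrier A. y = f x" if "y \<in> carrier B" for y
    using bij_betw_imp_surj_on[OF bij] that by blast
  have zero: "f x = \<zero>\<^bsub>B\<^esub> \<longleftrightarrow> x = \<zero>\<^bsub>A\<^esub>" if "x \<in> carrier A" for x
    using inj[OF that A.zero_closed] by simp
  have cn: "f z \<in> central_nilpotents B \<longleftrightarrow> z \<in> central_nilpotents A" if z: "z \<in> carrier A" for z
  proof -
    have "(\<forall>y\<in>carrier B. f z \<otimes>\<^bsub>B\<^esub> y = y \<otimes>\<^bsub>B\<^esub> f z) \<longleftrightarrow>
        (\<forall>x\<in>carrier A. f (z \<otimes>\<^bsub>A\<^esub> x) = f (x \<otimes>\<^bsub>A\<^esub> z))"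
    proof
      assume "\<forall>y\<in>carrier B. f z \<otimes>\<^bsub>B\<^esub> y = y \<otimes>\<^bsub>B\<^esub> f z"
      then show "\<forall>x\<in>carrier A. f (z \<otimes>\<^bsub>A\<^esub> x) = f (x \<otimes>\<^bsub>A\<^esub> z)"
        using z by simp
    next
      assume *: "\<forall>x\<in>carrier A. f (z \<otimes>\<^bsub>A\<^esub> x) = f (x \<otimes>\<^bsub>A\<^esub> z)"
      show "\<forall>y\<in>carrier B. f z \<otimes>\<^bsub>B\<^esub> y = y \<otimes>\<^bsub>B\<^esub> f z"
      proof
        fix y assume "y \<in> carrier B"
        then obtain x where "x \<in> carrier A" "y = f x" using surj by blast
        then show "f z \<otimes>\<^bsub>B\<^esub> y = y \<otimes>\<^bsub>B\<^esub> f z" using * z by (simp flip: f.hom_mult)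
      qed
    qed
    also have "\<dots> \<longleftrightarrow> (\<forall>x\<in>carrier A. z \<otimes>\<^bsub>A\<^esub> x = x \<otimes>\<^bsub>A\<^esub> z)"
      by (intro ball_cong[OF refl] inj A.m_closed z)
    moreover have "f z [^]\<^bsub>B\<^esub> m = \<zero>\<^bsub>B\<^esub> \<longleftrightarrow> z [^]\<^bsub>A\<^esub> m = \<zero>\<^bsub>A\<^esub>" for m :: nat
      using zero[of "z [^]\<^bsub>A\<^esub> m"] z by (simp add: f.hom_nat_pow)
    ultimately show ?thesis
      using z by (simp add: central_nilpotents_def)
  qed
  have pw: "f z [^]\<^bsub>B\<^esub> k \<otimes>\<^bsub>B\<^esub> f x = \<zero>\<^bsub>B\<^esub> \<longleftrightarrow> z [^]\<^bsub>A\<^esub> k \<otimes>\<^bsub>A\<^esub> x = \<zero>\<^bsub>A\<^esub>"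
    if "z \<in> carrier A" "x \<in> carrier A" for z x and k :: nat
    using zero[of "z [^]\<^bsub>A\<^esub> k \<otimes>\<^bsub>A\<^esub> x"] that by (simp add: f.hom_nat_pow)
  have sub: "central_nilpotents A \<subseteq> carrier A" "central_nilpotents B \<subseteq> carrier B"
    by (auto simp: central_nilpotents_def)
  fix k assume "k \<in> idempotent_levels A"
  then obtain x z where x: "x \<in> carrier A" "x \<otimes>\<^bsub>A\<^esub> x = x"
      "\<And>z. z \<in> central_nilpotents A \<Longrightarrow> z [^]\<^bsub>A\<^esub> k \<otimes>\<^bsub>A\<^esub> x = \<zero>\<^bsub>A\<^esub>"
    and z: "z \<in> central_nilpotents A" "z [^]\<^bsub>A\<^esub> (k - 1) \<otimes>\<^bsub>A\<^esub> x \<noteq> \<zero>\<^bsub>A\<^esub>"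
    by (auto simp: idempotent_levels_def)
  have zA: "z \<in> carrier A" using z(1) sub by blast
  have "f x \<otimes>\<^bsub>B\<^esub> f x = f x" using x(1,2) f.hom_mult[of x x] by simp
  moreover have "w [^]\<^bsub>B\<^esub> k \<otimes>\<^bsub>B\<^esub> f x = \<zero>\<^bsub>B\<^esub>" if w: "w \<in> central_nilpotents B" for w
  proof -
    obtain v where v: "v \<in> carrier A" "w = f v" using surj[of w] sub w by blast
    then have "v \<in> central_nilpotents A" using w cn[OF v(1)] by simp
    then show ?thesis using pw[OF v(1) x(1), of k] x(3) v(2) by simp
  qed
  moreover have "f z [^]\<^bsub>B\<^esub> (k - 1) \<otimes>\<^bsub>B\<^esub> f x \<noteq> \<zero>\<^bsub>B\<^esub>"
    using pw[OF zA x(1)] z(2) by simp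
  moreover have "f x \<in> carrier B" "f z \<in> central_nilpotents B"
    using x(1) cn[OF zA] z(1) by auto
  ultimately show "k \<in> idempotent_levels B"
    unfolding idempotent_levels_def mem_Collect_eq
    by (intro bexI[of _ "f x"] bexI[of _ "f z"] conjI ballI)
qed

lemma idempotent_levels_iso:
  assumes "f \<in> ring_iso A B" "ring A" "ring B"
  shows "idempotent_levels A = idempotent_levels B"
  using idempotent_levels_mono[OF assms]
    idempotent_levels_mono[OF ring_iso_set_sym[OF assms(2,1)] assms(3,2)] by blast

section \<open>Units and powers of an element\<close>

lemma (in ring) one_minus_add:
  assumes "a \<in> carrier R"
  shows "(\<one> \<ominus> a) \<oplus> a = \<one>"
  using assms by (simp add: minus_eq a_assoc l_neg)

lemma (in cring) unit_mult_eq_zero: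
  assumes a: "a \<in> Units R" and b: "b \<in> carrier R" "a \<otimes> b = \<zero>"
  shows "b = \<zero>"
proof -
  have "b = (inv a \<otimes> a) \<otimes> b"
    by (simp only: Units_l_inv[OF a] l_one[OF b(1)])
  also have "\<dots> = inv a \<otimes> (a \<otimes> b)"
    by (rule m_assoc[OF Units_inv_closed[OF a] Units_closed[OF a] b(1)])
  also have "\<dots> = \<zero>"
    by (simp only: b(2) r_null[OF Units_inv_closed[OF a]])
  finally show ?thesis .
qed

text \<open>The equation says that \<open>\<one> \<ominus> c \<otimes> p\<close> annihilates
  \<open>p [^] m\<close>, and the unit cancels: Nakayama's lemma for a principal ideal.\<close>

lemma (in cring) power_eq_zero:
  assumes p: "p \<in> carrier R" and c: "c \<in> carrier R"
    and unit: "\<one> \<ominus> c \<otimes> p \<in> Units R" and eq: "p [^] m = c \<otimes> p [^] Suc m"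
  shows "p [^] (m::nat) = \<zero>"
proof (rule unit_mult_eq_zero[OF unit])
  have "c \<otimes> p \<otimes> p [^] m = c \<otimes> p [^] Suc m"
    using c p by (simp add: m_ac)
  also have "\<dots> = p [^] m" by (rule eq[symmetric])
  finally show "(\<one> \<ominus> c \<otimes> p) \<otimes> p [^] m = \<zero>"
    using c p by (simp add: minus_eq l_distr l_minus r_neg)
qed (use p in simp)

text \<open>Collects what is used of a local principal ring: an element \<open>p\<close> of
  nilpotency index \<open>N\<close> such that every nonunit is a multiple of \<open>p\<close>. The
  condition \<open>q s = N\<close> makes the last summand a copy of \<open>P\<close> itself.\<close>

locale uniserial_sum = quotient_sum P s I
  for P :: "('r, 'a) module" (structure) and s :: nat and I :: "nat \<Rightarrow> 'a set" +
  fixes p :: 'a and N :: nat and q :: "nat \<Rightarrow> nat"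
  assumes p_closed [simp]: "p \<in> carrier P"
    and unit_or_multiple: "a \<in> carrier P \<Longrightarrow> a \<in> Units P \<or> (\<exists>b\<in>carrier P. a = p \<otimes> b)"
    and p_pow_N: "p [^] N = \<zero>"
    and p_pow_nonzero: "k < N \<Longrightarrow> p [^] k \<noteq> \<zero>"
    and N_pos: "0 < N"
    and s_pos: "1 \<le> s"
    and q_pos: "i \<in> {1..s} \<Longrightarrow> 0 < q i"
    and q_le: "i \<in> {1..s} \<Longrightarrow> q i \<le> N"
    and q_last: "q s = N"
    and I_eq: "i \<in> {1..s} \<Longrightarrow> I i = PIdl (p [^] q i)"
begin

sublocale Q: lmodule P qsum
  by (rule lmodule_qsum)

abbreviation "E \<equiv> End_alg P qsum"

sublocale E: ring E
  by (rule End_alg_ring[OF lmodule_qsum])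

lemma mem_I: "i \<in> {1..s} \<Longrightarrow> a \<in> I i \<longleftrightarrow> (\<exists>b\<in>carrier P. a = b \<otimes> p [^] q i)"
  by (auto simp: I_eq cgenideal_def)

lemma one_ne_zero: "\<one> \<noteq> \<zero>"
  using p_pow_nonzero[of 0] N_pos by simp

lemma unit_pow: "a \<in> Units P \<Longrightarrow> a [^] (k::nat) \<in> Units P"
  by (induction k) auto

lemma p_not_unit: "p \<notin> Units P"
proof
  assume "p \<in> Units P"
  then have "p [^] N \<in> Units P" by (rule unit_pow)
  then show False
    using p_pow_N one_ne_zero unit_mult_eq_zero[of \<zero> \<one>] by simp
qed

text \<open>If \<open>\<one> \<ominus> c \<otimes> p\<close> were a multiple of \<open>p\<close>, so
  would be \<open>\<one>\<close>, and \<open>p\<close> would be a unit.\<close>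

lemma one_minus_multiple_unit:
  assumes "c \<in> carrier P"
  shows "\<one> \<ominus> c \<otimes> p \<in> Units P"
proof (rule ccontr)
  assume "\<one> \<ominus> c \<otimes> p \<notin> Units P"
  then obtain b where b: "b \<in> carrier P" "\<one> \<ominus> c \<otimes> p = p \<otimes> b"
    using unit_or_multiple[of "\<one> \<ominus> c \<otimes> p"] assms by auto
  have "p \<otimes> (b \<oplus> c) = (\<one> \<ominus> c \<otimes> p) \<oplus> c \<otimes> p"
    using b assms by (simp add: r_distr m_comm)
  also have "\<dots> = \<one>"
    using assms by (simp add: one_minus_add)
  finally have "p \<in> Units P"
    using assms b by (auto simp: Units_def m_comm intro!: bexI[of _ "b \<oplus> c"])
  then show False using p_not_unit by simp
qed

text \<open>Otherwise \<open>p [^] (q i - 1)\<close> would vanish by \<open>power_eq_zero\<close>,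
  although its exponent is below \<open>N\<close>. So \<open>q i\<close> is the least exponent for
  which the power of \<open>p\<close> kills summand \<open>i\<close>.\<close>

lemma p_pow_notin:
  assumes "i \<in> {1..s}"
  shows "p [^] (q i - 1) \<notin> I i"
proof
  assume "p [^] (q i - 1) \<in> I i"
  then obtain c where c: "c \<in> carrier P" "p [^] (q i - 1) = c \<otimes> p [^] q i"
    using mem_I[OF assms] by auto
  have "Suc (q i - 1) = q i" using q_pos[OF assms] by simp
  then have "p [^] (q i - 1) = \<zero>"
    using c by (intro power_eq_zero[OF p_closed c(1) one_minus_multiple_unit[OF c(1)]]) simp
  moreover have "q i - 1 < N" using q_pos[OF assms] q_le[OF assms] by simp
  ultimately show False using p_pow_nonzero by blast
qed

lemma I_last: "I s = {\<zero>}"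
  using s_pos mem_I[of s] by (auto simp: q_last p_pow_N)

section \<open>Scalar multiplications and the centre of the endomorphism ring\<close>

definition scal :: "'a \<Rightarrow> (nat \<Rightarrow> 'a set) \<Rightarrow> nat \<Rightarrow> 'a set" where
  "scal a = (\<lambda>x\<in>carrier qsum. a \<odot>\<^bsub>qsum\<^esub> x)"

lemma scal_cls:
  assumes "a \<in> carrier P" "\<And>i. i \<in> {1..s} \<Longrightarrow> r i \<in> carrier P"
  shows "scal a (cls r) = cls (\<lambda>i. a \<otimes> r i)"
proof -
  have "cls r \<in> carrier qsum" by (rule cls_closed) (rule assms)
  moreover have "a \<odot>\<^bsub>qsum\<^esub> cls r = cls (\<lambda>i. a \<otimes> r i)"
    by (rule cls_smult[OF assms(1)]) (rule assms(2))
  ultimately show ?thesis by (simp add: scal_def)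
qed

lemma scal_closed: "a \<in> carrier P \<Longrightarrow> scal a \<in> carrier E"
  unfolding scal_def
proof (rule End_algI)
  fix b x assume "a \<in> carrier P" "b \<in> carrier P" "x \<in> carrier qsum"
  then show "(\<lambda>x\<in>carrier qsum. a \<odot>\<^bsub>qsum\<^esub> x) (b \<odot>\<^bsub>qsum\<^esub> x) =
      b \<odot>\<^bsub>qsum\<^esub> (\<lambda>x\<in>carrier qsum. a \<odot>\<^bsub>qsum\<^esub> x) x"
    by (simp add: Q.smult_closed Q.smult_assoc[symmetric] m_comm)
qed (auto simp: Q.smult_closed Q.smult_r_distr)

lemma E_mult: "x \<in> carrier qsum \<Longrightarrow> (f \<otimes>\<^bsub>E\<^esub> f') x = f (f' x)"
  by (simp add: End_alg_sel compose_def)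

lemma E_zero: "x \<in> carrier qsum \<Longrightarrow> \<zero>\<^bsub>E\<^esub> x = cls (\<lambda>_. \<zero>)"
  by (simp add: End_alg_sel zero_qsum)

lemma scal_central:
  assumes "a \<in> carrier P" "f \<in> carrier E"
  shows "scal a \<otimes>\<^bsub>E\<^esub> f = f \<otimes>\<^bsub>E\<^esub> scal a"
proof (rule End_alg_eqI)
  fix x assume x: "x \<in> carrier qsum"
  then show "(scal a \<otimes>\<^bsub>E\<^esub> f) x = (f \<otimes>\<^bsub>E\<^esub> scal a) x"
    using assms End_algD[OF assms(2)] by (simp add: E_mult) (simp add: scal_def)
qed (use assms in \<open>auto simp: scal_closed\<close>)

lemma scal_mult:
  assumes "a \<in> carrier P" "b \<in> carrier P"
  shows "scal a \<otimes>\<^bsub>E\<^esub> scal b = scal (a \<otimes> b)"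
proof (rule End_alg_eqI)
  fix x assume x: "x \<in> carrier qsum"
  then show "(scal a \<otimes>\<^bsub>E\<^esub> scal b) x = scal (a \<otimes> b) x"
    using assms by (simp add: E_mult) (simp add: scal_def Q.smult_closed Q.smult_assoc)
qed (use assms in \<open>auto simp: scal_closed\<close>)

lemma scal_pow:
  assumes "a \<in> carrier P"
  shows "scal a [^]\<^bsub>E\<^esub> (k::nat) = scal (a [^] k)"
proof (induction k)
  case 0
  have "scal \<one> = \<one>\<^bsub>E\<^esub>"
    by (auto simp: scal_def End_alg_sel Q.smult_one intro: restrict_ext)
  then show ?case by simp
next
  case (Suc k)
  then show ?case using assms by (simp add: scal_mult)
qed

text \<open>The generator of the last summand, on which \<open>P\<close> acts faithfully since
  \<open>I s = {\<zero>}\<close>.\<close>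

definition unit_last :: "nat \<Rightarrow> 'a set" where
  "unit_last = cls (\<lambda>i. if i = s then \<one> else \<zero>)"

lemma unit_last_closed: "unit_last \<in> carrier qsum"
  by (auto simp: unit_last_def intro: cls_closed)

lemma scal_zero_iff:
  assumes "a \<in> carrier P"
  shows "scal a = \<zero>\<^bsub>E\<^esub> \<longleftrightarrow> a = \<zero>"
proof
  assume *: "scal a = \<zero>\<^bsub>E\<^esub>"
  have "cls (\<lambda>i. a \<otimes> (if i = s then \<one> else \<zero>)) = cls (\<lambda>_. \<zero>)"
    using assms fun_cong[OF *, of unit_last] E_zero[OF unit_last_closed]
    by (simp add: unit_last_def scal_cls)
  then have "\<forall>i\<in>{1..s}. a \<otimes> (if i = s then \<one> else \<zero>) \<ominus> \<zero> \<in> I i"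
    using assms by (subst (asm) cls_eq_iff) auto
  then have "a \<otimes> \<one> \<ominus> \<zero> \<in> I s"
    using s_pos by (force dest: bspec[where x = s])
  then show "a = \<zero>"
    using assms by (simp add: I_last minus_eq)
next
  assume "a = \<zero>"
  then show "scal a = \<zero>\<^bsub>E\<^esub>"
    by (intro End_alg_eqI[OF scal_closed]) (auto elim!: qsumE simp: scal_cls E_zero)
qed

text \<open>A central element commutes with every map \<open>y \<mapsto> y\<^sub>s x\<close>, where \<open>y\<^sub>s \<in> P/p\<^sup>N = P\<close>; so it is
  determined by its value at the unit vector of the last summand.\<close>

lemma central_imp_scal:
  assumes c: "c \<in> carrier E" and comm: "\<And>f. f \<in> carrier E \<Longrightarrow> c \<otimes>\<^bsub>E\<^esub> f = f \<otimes>\<^bsub>E\<^esub> c"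
  obtains a where "a \<in> carrier P" "c = scal a"
proof -
  have last: "cls r s = {r s}" if "\<And>i. i \<in> {1..s} \<Longrightarrow> r i \<in> carrier P" for r
    using s_pos that by (simp add: cls_def I_last a_r_coset_def')
  obtain r where r: "\<And>i. r i \<in> carrier P" "c unit_last = cls r"
    using End_algD(1)[OF c unit_last_closed] by (rule qsumE) blast
  have "c x = scal (r s) x" if x: "x \<in> carrier qsum" for x
  proof -
    \<comment> \<open>\<open>y s\<close> is a coset of the zero ideal, hence a singleton that
      \<open>the_elem\<close> unpacks. Evaluating both composites of \<open>c\<close> and
      \<open>f\<close> at \<open>unit_last\<close> gives \<open>c x\<close> on one side and the
      multiple of \<open>x\<close> by \<open>r s\<close> on the other.\<close>
    define f where "f = (\<lambda>y\<in>carrier qsum. the_elem (y s) \<odot>\<^bsub>qsum\<^esub> x)"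
    have f_cls: "f (cls t) = t s \<odot>\<^bsub>qsum\<^esub> x" if "\<And>i. i \<in> {1..s} \<Longrightarrow> t i \<in> carrier P" for t
    proof -
      have "cls t \<in> carrier qsum" by (rule cls_closed) (rule that)
      then show ?thesis using last[OF that] by (simp add: f_def)
    qed
    have sP: "t s \<in> carrier P" if "\<And>i. i \<in> {1..s} \<Longrightarrow> t i \<in> carrier P" for t
      using that s_pos by simp
    have "f \<in> carrier E"
    proof (rule End_algI)
      fix y z assume "y \<in> carrier qsum" "z \<in> carrier qsum"
      then show "f (y \<oplus>\<^bsub>qsum\<^esub> z) = f y \<oplus>\<^bsub>qsum\<^esub> f z"
        using x by (elim qsumE[of y] qsumE[of z]) (simp add: cls_add f_cls sP Q.smult_l_distr)
    next
      fix a y assume "a \<in> carrier P" "y \<in> carrier qsum"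
      then show "f (a \<odot>\<^bsub>qsum\<^esub> y) = a \<odot>\<^bsub>qsum\<^esub> f y"
        using x by (elim qsumE[of y]) (simp add: cls_smult f_cls sP Q.smult_assoc)
    qed (use x in \<open>auto elim!: qsumE simp: f_cls f_def Q.smult_closed last cls_closed\<close>)
    have "c (f unit_last) = f (c unit_last)"
      using fun_cong[OF comm[OF \<open>f \<in> carrier E\<close>], of unit_last] by (simp add: E_mult unit_last_closed)
    moreover have "f unit_last = x"
      using x by (simp add: unit_last_def f_cls Q.smult_one)
    ultimately show ?thesis
      using x r by (simp add: f_cls scal_def)
  qed
  then have "c = scal (r s)"
    using r by (intro End_alg_eqI[OF c scal_closed]) auto
  then show thesis using that r by blast
qed

text \<open>Central elements are scalars. A nilpotent scalar is not a unit, hence a multiple of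
  \<open>p\<close>; conversely \<open>p [^] N = \<zero>\<close> makes all multiples of
  \<open>p\<close> nilpotent.\<close>

lemma central_nilpotents_E: "central_nilpotents E = {scal (p \<otimes> b) | b. b \<in> carrier P}"
proof
  show "central_nilpotents E \<subseteq> {scal (p \<otimes> b) | b. b \<in> carrier P}"
  proof
    fix z assume z: "z \<in> central_nilpotents E"
    then obtain a where a: "a \<in> carrier P" "z = scal a"
      by (auto simp: central_nilpotents_def elim: central_imp_scal)
    obtain m :: nat where "z [^]\<^bsub>E\<^esub> m = \<zero>\<^bsub>E\<^esub>"
      using z by (auto simp: central_nilpotents_def)
    then have "a [^] m = \<zero>"
      using a by (simp add: scal_pow scal_zero_iff)
    then have "a \<notin> Units P"
      using unit_pow[of a m] one_ne_zero unit_mult_eq_zero[of \<zero> \<one>] by auto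
    then show "z \<in> {scal (p \<otimes> b) | b. b \<in> carrier P}"
      using unit_or_multiple[OF a(1)] a(2) by auto
  qed
  have "(p \<otimes> b) [^] N = \<zero>" if "b \<in> carrier P" for b
    using that by (simp add: nat_pow_distrib p_pow_N)
  then show "{scal (p \<otimes> b) | b. b \<in> carrier P} \<subseteq> central_nilpotents E"
    by (auto simp: central_nilpotents_def scal_closed scal_central scal_pow scal_zero_iff
        intro!: exI[of _ N])
qed

section \<open>Levels of idempotents and the exponents\<close>

lemma level_if_exponent:
  assumes i: "i \<in> {1..s}"
  shows "q i \<in> idempotent_levels E"
proof -
  \<comment> \<open>The projection onto summand \<open>i\<close>; the coset \<open>I j\<close> is
    the zero of summand \<open>j\<close>.\<close>
  define e where "e = (\<lambda>x\<in>carrier qsum. \<lambda>j\<in>{1..s}. if j = i then x j else I j)"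
  have e_cls: "e (cls r) = cls (\<lambda>j. if j = i then r j else \<zero>)"
    if "\<And>j. j \<in> {1..s} \<Longrightarrow> r j \<in> carrier P" for r
  proof -
    have "cls r \<in> carrier qsum" by (rule cls_closed) (rule that)
    then show ?thesis
      using coset_zero
      by (simp add: e_def) (auto simp: cls_def intro!: restrict_ext)
  qed
  have e: "e \<in> carrier E"
  proof (rule End_algI)
    fix x assume "x \<in> carrier qsum"
    then show "e x \<in> carrier qsum"
      by (elim qsumE) (auto simp: e_cls intro!: cls_closed)
  next
    fix x y assume "x \<in> carrier qsum" "y \<in> carrier qsum"
    then show "e (x \<oplus>\<^bsub>qsum\<^esub> y) = e x \<oplus>\<^bsub>qsum\<^esub> e y"
      by (elim qsumE) (auto simp: e_cls cls_add intro!: cls_cong)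
  next
    fix a x assume "a \<in> carrier P" "x \<in> carrier qsum"
    then show "e (a \<odot>\<^bsub>qsum\<^esub> x) = a \<odot>\<^bsub>qsum\<^esub> e x"
      by (elim qsumE) (auto simp: e_cls cls_smult intro!: cls_cong)
  qed (simp add: e_def)
  have "e \<otimes>\<^bsub>E\<^esub> e = e"
    using e by (intro End_alg_eqI[OF _ e]) (auto elim!: qsumE simp: E_mult e_cls intro!: cls_cong)
  moreover have "z [^]\<^bsub>E\<^esub> q i \<otimes>\<^bsub>E\<^esub> e = \<zero>\<^bsub>E\<^esub>" if z: "z \<in> central_nilpotents E" for z
  proof -
    obtain b where b: "b \<in> carrier P" "z = scal (p \<otimes> b)"
      using z by (auto simp: central_nilpotents_E)
    have "scal ((p \<otimes> b) [^] q i) (e (cls r)) = cls (\<lambda>_. \<zero>)" if r: "\<And>j. r j \<in> carrier P" for r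
    proof -
      have "(p \<otimes> b) [^] q i \<otimes> r i \<in> I i"
        using b r by (auto simp: mem_I[OF i] nat_pow_distrib m_ac intro!: bexI[of _ "b [^] q i \<otimes> r i"])
      then show ?thesis
        using b r zero_in_I by (auto simp: e_cls scal_cls cls_eq_iff minus_eq)
    qed
    then show ?thesis
      using b e by (intro End_alg_eqI[of _ P qsum])
        (auto elim!: qsumE simp: scal_pow scal_closed E_mult E_zero)
  qed
  moreover have "scal p [^]\<^bsub>E\<^esub> (q i - 1) \<otimes>\<^bsub>E\<^esub> e \<noteq> \<zero>\<^bsub>E\<^esub>"
  proof
    \<comment> \<open>The projection sends the all-ones vector to the generator of summand
      \<open>i\<close>, which \<open>p [^] (q i - 1)\<close> does not kill.\<close>
    let ?u = "\<lambda>j::nat. \<one>"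
    have u: "cls ?u \<in> carrier qsum" by (rule cls_closed) simp
    assume "scal p [^]\<^bsub>E\<^esub> (q i - 1) \<otimes>\<^bsub>E\<^esub> e = \<zero>\<^bsub>E\<^esub>"
    then have "(scal (p [^] (q i - 1)) \<otimes>\<^bsub>E\<^esub> e) (cls ?u) = \<zero>\<^bsub>E\<^esub> (cls ?u)"
      by (simp add: scal_pow)
    then have "cls (\<lambda>j. p [^] (q i - 1) \<otimes> (if j = i then \<one> else \<zero>)) = cls (\<lambda>_. \<zero>)"
      using u by (simp add: E_mult E_zero e_cls scal_cls)
    then have "\<forall>j\<in>{1..s}. p [^] (q i - 1) \<otimes> (if j = i then \<one> else \<zero>) \<ominus> \<zero> \<in> I j"
      by (subst (asm) cls_eq_iff) auto
    then have "p [^] (q i - 1) \<otimes> \<one> \<ominus> \<zero> \<in> I i"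
      using i by (force dest: bspec[where x = i])
    then have "p [^] (q i - 1) \<in> I i"
      by (simp add: minus_eq)
    then show False using p_pow_notin[OF i] by simp
  qed
  moreover have "scal p \<in> central_nilpotents E"
    by (auto simp: central_nilpotents_E intro!: exI[of _ \<one>])
  ultimately show ?thesis
    using e by (auto simp: idempotent_levels_def)
qed

lemma exponent_if_level:
  assumes k: "k \<in> idempotent_levels E" "0 < k"
  shows "k \<in> q ` {1..s}"
proof (rule ccontr)
  assume nk: "k \<notin> q ` {1..s}"
  obtain x z where x: "x \<in> carrier E" "x \<otimes>\<^bsub>E\<^esub> x = x"
      "\<And>z. z \<in> central_nilpotents E \<Longrightarrow> z [^]\<^bsub>E\<^esub> k \<otimes>\<^bsub>E\<^esub> x = \<zero>\<^bsub>E\<^esub>"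
    and z: "z \<in> central_nilpotents E" "z [^]\<^bsub>E\<^esub> (k - 1) \<otimes>\<^bsub>E\<^esub> x \<noteq> \<zero>\<^bsub>E\<^esub>"
    using k(1) by (auto simp: idempotent_levels_def)
  have "scal p [^]\<^bsub>E\<^esub> k \<otimes>\<^bsub>E\<^esub> x = \<zero>\<^bsub>E\<^esub>"
    by (rule x(3)) (auto simp: central_nilpotents_E intro!: exI[of _ \<one>])
  then have pk: "scal (p [^] k) \<otimes>\<^bsub>E\<^esub> x = \<zero>\<^bsub>E\<^esub>"
    by (simp only: scal_pow[OF p_closed])
  have kill: "scal (p [^] k) (x m) = cls (\<lambda>_. \<zero>)" if "m \<in> carrier qsum" for m
    by (simp only: E_mult[OF that, symmetric] pk E_zero[OF that])
  have "scal (p [^] (k - 1)) (x m) = cls (\<lambda>_. \<zero>)" if m: "m \<in> carrier qsum" for m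
  proof -
    obtain y where y: "\<And>i. y i \<in> carrier P" "x m = cls y"
      using End_algD(1)[OF x(1) m] by (rule qsumE) blast
    \<comment> \<open>Coordinate \<open>i\<close> of \<open>p [^] (k - 1)\<close> times
      \<open>y\<close> is to be a multiple of \<open>p [^] k\<close> modulo \<open>I i\<close>. For
      \<open>q i < k\<close> it already lies in \<open>I i\<close>; for \<open>k < q i\<close> the
      entry \<open>y i\<close> turns out to be divisible by \<open>p\<close>.\<close>
    have "\<exists>t\<in>carrier P. p [^] (k - 1) \<otimes> y i \<ominus> p [^] k \<otimes> t \<in> I i" if i: "i \<in> {1..s}" for i
    proof (cases "q i < k")
      case True
      have "p [^] (k - 1) = p [^] (k - 1 - q i) \<otimes> p [^] q i"
        using True by (simp add: nat_pow_mult)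
      then have "p [^] (k - 1) \<otimes> y i \<in> I i"
        using y(1)[of i] by (auto simp: mem_I[OF i] m_ac intro!: bexI[of _ "p [^] (k - 1 - q i) \<otimes> y i"])
      then show ?thesis
        using y(1)[of i] by (intro bexI[of _ \<zero>]) (auto simp: minus_eq)
    next
      case False
      then have kq: "k < q i" using nk i by (metis image_eqI linorder_neqE_nat)
      have "y i \<notin> Units P"
      proof
        \<comment> \<open>As \<open>p [^] k\<close> kills \<open>x m\<close>, the element
          \<open>p [^] k \<otimes> y i\<close> is a multiple of \<open>p [^] q i\<close>.
          Multiplying by \<open>p [^] (N - q i)\<close> and cancelling the unit annihilates a power
          of \<open>p\<close> with exponent below \<open>N\<close>.\<close>
        assume unit: "y i \<in> Units P"
        have "cls (\<lambda>i. p [^] k \<otimes> y i) = cls (\<lambda>_. \<zero>)"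
          using kill[OF m] y by (simp add: scal_cls)
        then have "p [^] k \<otimes> y i \<in> I i"
          using y(1) i by (subst (asm) cls_eq_iff) (auto simp: minus_eq)
        then obtain b where b: "b \<in> carrier P" "p [^] k \<otimes> y i = b \<otimes> p [^] q i"
          by (auto simp: mem_I[OF i])
        have "p [^] (N - q i) \<otimes> p [^] q i = \<zero>"
          using q_le[OF i] by (simp add: nat_pow_mult p_pow_N)
        have "y i \<otimes> p [^] (N - q i + k) = p [^] (N - q i) \<otimes> (p [^] k \<otimes> y i)"
          using y(1)[of i] by (simp add: nat_pow_mult[symmetric] m_ac)
        also have "\<dots> = b \<otimes> (p [^] (N - q i) \<otimes> p [^] q i)"
          unfolding b(2) using b(1) by (simp add: m_ac)
        also have "\<dots> = \<zero>"
          using b(1) \<open>p [^] (N - q i) \<otimes> p [^] q i = \<zero>\<close> by simp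
        finally have "y i \<otimes> p [^] (N - q i + k) = \<zero>" .
        then have "p [^] (N - q i + k) = \<zero>"
          using unit unit_mult_eq_zero by simp
        moreover have "N - q i + k < N"
          using kq q_le[OF i] by simp
        ultimately show False using p_pow_nonzero by blast
      qed
      then obtain t where t: "t \<in> carrier P" "y i = p \<otimes> t"
        using unit_or_multiple[OF y(1)[of i]] by auto
      have "p [^] k = p [^] (k - 1) \<otimes> p"
        using k(2) nat_pow_Suc[of p "k - 1"] by simp
      then have "p [^] (k - 1) \<otimes> y i \<ominus> p [^] k \<otimes> t = \<zero>"
        using t by (simp add: m_assoc minus_eq r_neg)
      then show ?thesis
        using t(1) zero_in_I[OF i] by (intro bexI[of _ t]) simp_all
    qed
    then have "\<forall>i. \<exists>t\<in>carrier P. i \<in> {1..s} \<longrightarrow> p [^] (k - 1) \<otimes> y i \<ominus> p [^] k \<otimes> t \<in> I i"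
      using zero_closed by blast
    then obtain t where t: "\<And>i. t i \<in> carrier P"
        "\<And>i. i \<in> {1..s} \<Longrightarrow> p [^] (k - 1) \<otimes> y i \<ominus> p [^] k \<otimes> t i \<in> I i"
      by metis
    have "scal (p [^] (k - 1)) (x m) = scal (p [^] k) (cls t)"
      using y t by (simp add: scal_cls cls_eq_iff)
    \<comment> \<open>Idempotency enters here: applying \<open>x\<close> leaves the left side
      unchanged, since \<open>x (x m) = x m\<close>, while the right side becomes
      \<open>p [^] k\<close> times a value of \<open>x\<close>, which is zero by
      \<open>kill\<close>.\<close>
    then have "x (scal (p [^] (k - 1)) (x m)) = x (scal (p [^] k) (cls t))"
      by simp
    moreover have "x (scal (p [^] j) n) = scal (p [^] j) (x n)" if "n \<in> carrier qsum" for j :: nat and n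
      using fun_cong[OF scal_central[OF _ x(1), of "p [^] j"], of n] that by (simp add: E_mult)
    moreover have "x (x m) = x m"
      using fun_cong[OF x(2), of m] m by (simp add: E_mult)
    ultimately show ?thesis
      using End_algD(1)[OF x(1) m] kill[OF cls_closed[OF t(1)]] cls_closed[OF t(1)] by simp
  qed
  then have "scal (p [^] (k - 1)) \<otimes>\<^bsub>E\<^esub> x = \<zero>\<^bsub>E\<^esub>"
    using x(1) by (intro End_alg_eqI[of _ P qsum]) (auto simp: scal_closed E_mult E_zero)
  moreover obtain b where b: "b \<in> carrier P" "z = scal (p \<otimes> b)"
    using z(1) by (auto simp: central_nilpotents_E)
  \<comment> \<open>Every central nilpotent is \<open>scal (p \<otimes> b)\<close>, so its power
    with exponent \<open>k - 1\<close> is a multiple of \<open>scal (p [^] (k - 1))\<close>, whose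
    product with \<open>x\<close> is zero.\<close>
  have "z [^]\<^bsub>E\<^esub> (k - 1) = scal (b [^] (k - 1)) \<otimes>\<^bsub>E\<^esub> scal (p [^] (k - 1))"
    using b by (simp add: scal_pow scal_mult nat_pow_distrib m_comm)
  ultimately show False
    using z(2) x(1) b(1) by (simp add: E.m_assoc scal_closed)
qed

text \<open>Zero is set aside because \<open>exponent_if_level\<close> splits one factor
  \<open>p\<close> off \<open>p [^] k\<close>; nothing is lost, as all exponents are
  positive.\<close>

lemma idempotent_levels_E: "idempotent_levels E - {0} = q ` {1..s}"
  using level_if_exponent exponent_if_level q_pos by fastforce

end

section \<open>Local principal algebras\<close>

text \<open>Translates powers in the monoid of ideals, by which \<open>rad_power\<close> is defined,
  into powers of a generator.\<close>

lemma (in cring) ideals_set_pow: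
  assumes "p \<in> carrier R"
  shows "PIdl p [^]\<^bsub>ideals_set R\<^esub> n = PIdl (p [^] (n::nat))"
proof (induction n)
  interpret S: comm_monoid "ideals_set R" by (rule ideals_set_is_comm_monoid)
  case 0
  have "PIdl \<one> = carrier R" by (rule ideal.one_imp_carrier[OF cgenideal_ideal cgenideal_self]) simp_all
  then show ?case by (simp add: ideals_set_def)
next
  interpret S: comm_monoid "ideals_set R" by (rule ideals_set_is_comm_monoid)
  case (Suc n)
  have "ideal_prod R (PIdl (p [^] n)) (PIdl p) = Idl (PIdl (p [^] n) <#> PIdl p)"
    using assms by (intro ideal_prod_eq_genideal cgenideal_ideal) auto
  also have "\<dots> = Idl (PIdl (p [^] Suc n))"
    using assms by (simp add: cgenideal_prod)
  \<comment> \<open>The set product of the two principal ideals is already an ideal, so passing to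
    the generated ideal adds nothing.\<close>
  also have "\<dots> = PIdl (p [^] Suc n)"
  proof (rule antisym)
    have id: "ideal (PIdl (p [^] Suc n)) R" using assms by (intro cgenideal_ideal) auto
    show "Idl (PIdl (p [^] Suc n)) \<subseteq> PIdl (p [^] Suc n)"
      by (rule genideal_minimal[OF id]) simp
    show "PIdl (p [^] Suc n) \<subseteq> Idl (PIdl (p [^] Suc n))"
      using ideal.Icarr[OF id] by (intro genideal_self) auto
  qed
  finally show ?case
    using Suc by (simp add: ideals_set_def)
qed

lemma (in ring) Span_subset_ideal:
  assumes "K \<subseteq> carrier R" "ideal J R" "set Us \<subseteq> J"
  shows "Span K Us \<subseteq> J"
proof -
  interpret J: ideal J R by (rule assms)
  show ?thesis
    using assms(3)
  proof (induction Us)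
    case (Cons u Us)
    show ?case
    proof
      fix x assume "x \<in> Span K (u # Us)"
      then obtain k v where "k \<in> K" "v \<in> Span K Us" "x = k \<otimes> u \<oplus> v"
        by (auto simp: line_extension_mem_iff)
      then show "x \<in> J"
        using Cons assms(1) by (auto intro!: J.a_closed J.I_l_closed)
    qed
  qed auto
qed

text \<open>If the chain never stopped, no power \<open>p [^] a\<close> would lie in the span of the
  higher ones, as that span is inside \<open>PIdl (p [^] Suc a)\<close>. Arbitrarily many powers
  would then be linearly independent.\<close>

lemma (in cring) power_chain_stops:
  assumes K: "subfield K R" and fin: "finite_dimension K (carrier R)" and p: "p \<in> carrier R"
  obtains m :: nat where "p [^] m \<in> PIdl (p [^] Suc m)"
proof (rule ccontr)
  assume "\<not> thesis"
  with that have step: "p [^] m \<notin> PIdl (p [^] Suc m)" for m :: nat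
    by blast
  have KR: "K \<subseteq> carrier R" using subfieldE(3)[OF K] .
  have mem: "p [^] (m + j) \<in> PIdl (p [^] m)" for m j :: nat
    using p by (auto simp: cgenideal_def nat_pow_mult[symmetric] m_comm)
  \<comment> \<open>The induction extends the list at its head, by the lowest power, since this is
    the one kept out of the span of the others.\<close>
  have "independent K (map (\<lambda>i. p [^] i) [a..<b])" for a b :: nat
  proof (induction "b - a" arbitrary: a)
    case (Suc n)
    have "Span K (map (\<lambda>i. p [^] i) [Suc a..<b]) \<subseteq> PIdl (p [^] Suc a)"
    proof (rule Span_subset_ideal[OF KR])
      show "ideal (PIdl (p [^] Suc a)) R" using p by (intro cgenideal_ideal) auto
      show "set (map (\<lambda>i. p [^] i) [Suc a..<b]) \<subseteq> PIdl (p [^] Suc a)"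
      proof clarsimp
        fix i assume "Suc a \<le> i"
        then show "p [^] i \<in> PIdl (p [^] a \<otimes> p)"
          using mem[of "Suc a" "i - Suc a"] by simp
      qed
    qed
    then have "p [^] a \<notin> Span K (map (\<lambda>i. p [^] i) [Suc a..<b])"
      using step by blast
    moreover have "[a..<b] = a # [Suc a..<b]"
      using Suc(2) by (simp add: upt_conv_Cons)
    ultimately show ?case
      using Suc p by (auto simp del: Span.simps intro!: li_Cons)
  qed simp
  moreover obtain d where d: "dimension d K (carrier R)"
    using fin by blast
  ultimately have "length (map (\<lambda>i. p [^] i) [0..<Suc d]) \<le> d"
    using p by (intro independent_length_le_dimension[OF K d]) (auto simp del: upt_Suc)
  then show False by simp
qed

text \<open>Principal ideals make the ring noetherian, so a nonempty chain of ideals contains its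
  own union, and Zorn's lemma applies to the proper ideals through \<open>a\<close>. In a local ring
  this makes every element outside the maximal ideal a unit.\<close>

lemma (in cring) exists_maximalideal:
  assumes principal: "\<And>I. ideal I R \<Longrightarrow> principalideal I R"
    and a: "a \<in> carrier R" "a \<notin> Units R"
  obtains M where "maximalideal M R" "a \<in> M"
proof -
  interpret noetherian_ring R
    using principal by (intro noetherian_ringI) (meson finite.simps principalideal.generate
        insert_subset empty_subsetI)
  let ?A = "{I. ideal I R \<and> a \<in> I \<and> \<one> \<notin> I}"
  have "\<exists>M\<in>?A. \<forall>X\<in>?A. M \<subseteq> X \<longrightarrow> X = M"
  proof (rule subset_Zorn_nonempty)
    have "\<one> \<notin> PIdl a"
      using a by (auto simp: cgenideal_def Units_def m_comm)
    then show "?A \<noteq> {}"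
      using cgenideal_ideal[OF a(1)] cgenideal_self[OF a(1)] by blast
  next
    fix C assume "C \<noteq> {}" "subset.chain ?A C"
    then have "\<Union>C \<in> C"
      by (intro ideal_chain_is_trivial) (auto simp: subset.chain_def)
    then show "\<Union>C \<in> ?A"
      using \<open>subset.chain ?A C\<close> by (auto simp: subset.chain_def)
  qed
  then obtain M where M: "ideal M R" "a \<in> M" "\<one> \<notin> M"
      "\<And>X. ideal X R \<Longrightarrow> a \<in> X \<Longrightarrow> \<one> \<notin> X \<Longrightarrow> M \<subseteq> X \<Longrightarrow> X = M"
    by auto
  have "maximalideal M R"
  proof (rule maximalidealI)
    show "ideal M R" "carrier R \<noteq> M" using M by auto
    fix J assume J: "ideal J R" "M \<subseteq> J" "J \<subseteq> carrier R"
    show "J = M \<or> J = carrier R"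
      using M(2) M(4)[of J] J ideal.one_imp_carrier[OF J(1)] by blast
  qed
  then show thesis using that M(2) by blast
qed

context fd_local_principal_algebra
begin

text \<open>Passes from generators of an \<open>R\<close>-module to vector space dimension: the
  multiples of the identity by \<open>R\<close> form a subfield \<open>K\<close>, and the
  \<open>K\<close>-span of the generators is an \<open>R\<close>-submodule, hence
  everything.\<close>

lemma finite_dimension_scalars:
  obtains K where "subfield K \<O>" "finite_dimension K (carrier \<O>)"
proof -
  define h where "h = (\<lambda>r. r \<odot>\<^bsub>\<O>\<^esub> \<one>\<^bsub>\<O>\<^esub>)"
  have mult: "h r \<otimes>\<^bsub>\<O>\<^esub> x = r \<odot>\<^bsub>\<O>\<^esub> x" if "r \<in> carrier R" "x \<in> carrier \<O>" for r x
    using that by (simp add: h_def smult_assoc2)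
  interpret h: ring_hom_ring R \<O> h
  proof (rule ring_hom_ringI)
    fix x y assume xy: "x \<in> carrier R" "y \<in> carrier R"
    show "h (x \<otimes>\<^bsub>R\<^esub> y) = h x \<otimes>\<^bsub>\<O>\<^esub> h y"
      using xy mult[of x "h y"] by (simp add: h_def smult_assoc1)
    show "h (x \<oplus>\<^bsub>R\<^esub> y) = h x \<oplus>\<^bsub>\<O>\<^esub> h y"
      using xy by (simp add: h_def smult_l_distr)
  qed (auto simp: h_def R.ring_axioms ring_axioms)
  obtain M where "maximalideal M \<O>" using local by blast
  then have "\<one>\<^bsub>\<O>\<^esub> \<noteq> \<zero>\<^bsub>\<O>\<^esub>"
    by (metis one_zeroD additive_subgroup.zero_closed ideal.axioms(1) ideal.one_imp_carrier
        maximalideal.axioms(1) maximalideal.I_notcarr)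
  then have K: "subfield (h ` carrier R) \<O>"
    by (rule h.img_is_subfield(2)[OF R.carrier_is_subfield])
  obtain S where S: "finite S" "S \<subseteq> carrier \<O>"
      "\<And>N. submodule N R \<O> \<Longrightarrow> S \<subseteq> N \<Longrightarrow> N = carrier \<O>"
    using finite_dimensional by (auto simp: fin_gen_def)
  obtain Us where Us: "set Us = S" using finite_list[OF S(1)] by blast
  let ?N = "Span (h ` carrier R) Us"
  have "submodule ?N R \<O>"
  proof (intro submodule.intro submodule_axioms.intro)
    show "subgroup ?N (add_monoid \<O>)"
      using Us S(2) by (intro Span_is_add_subgroup[OF K]) auto
    fix a x assume ax: "a \<in> carrier R" "x \<in> ?N"
    have "x \<in> carrier \<O>"
      using ax(2) Span_in_carrier[of "h ` carrier R" Us] Us S(2) h.hom_closed by blast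
    moreover have "h a \<otimes>\<^bsub>\<O>\<^esub> x \<in> ?N"
      using ax Us S(2) by (intro Span_smult_closed[OF K]) auto
    ultimately show "a \<odot>\<^bsub>\<O>\<^esub> x \<in> ?N"
      using mult[OF ax(1)] by simp
  qed
  moreover have "S \<subseteq> ?N"
    using Span_base_incl[OF K] Us S(2) by blast
  ultimately have "?N = carrier \<O>" by (rule S(3))
  then show thesis
    using that[OF K] Span_finite_dimension[OF K, of Us] Us S(2) by simp
qed

text \<open>The generator \<open>p\<close> of the maximal ideal works. Finite dimension makes some
  \<open>p [^] m\<close> a multiple of \<open>p [^] Suc m\<close>, hence zero by
  \<open>power_eq_zero\<close>, so the Loewy length is the nilpotency index of
  \<open>p\<close>.\<close>

lemma uniformizer:
  obtains p where "p \<in> carrier \<O>" "\<And>n. rad_power \<O> n = PIdl\<^bsub>\<O>\<^esub> (p [^]\<^bsub>\<O>\<^esub> n)"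
    "\<And>a. a \<in> carrier \<O> \<Longrightarrow> a \<in> Units \<O> \<or> (\<exists>b\<in>carrier \<O>. a = p \<otimes>\<^bsub>\<O>\<^esub> b)"
    "p [^]\<^bsub>\<O>\<^esub> loewy_length \<O> = \<zero>\<^bsub>\<O>\<^esub>"
    "\<And>k. k < loewy_length \<O> \<Longrightarrow> p [^]\<^bsub>\<O>\<^esub> k \<noteq> \<zero>\<^bsub>\<O>\<^esub>"
    "0 < loewy_length \<O>"
proof -
  obtain J where J: "maximalideal J \<O>" and unique: "\<And>M. maximalideal M \<O> \<Longrightarrow> M = J"
    using local by blast
  interpret J: maximalideal J \<O> by (rule J)
  have one_notin: "\<one>\<^bsub>\<O>\<^esub> \<notin> J"
    using J.one_imp_carrier J.I_notcarr by blast
  have "{I. maximalideal I \<O>} = {J}" using J unique by blast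
  then have jac: "jacobson_radical \<O> = J"
    using J.Icarr by (auto simp: jacobson_radical_def)
  obtain p where p: "p \<in> carrier \<O>" "J = PIdl\<^bsub>\<O>\<^esub> p"
    using principalideal.generate[OF principal[OF J.is_ideal]] cgenideal_eq_genideal by auto
  have rad: "rad_power \<O> n = PIdl\<^bsub>\<O>\<^esub> (p [^]\<^bsub>\<O>\<^esub> n)" for n
    using ideals_set_pow[OF p(1)] by (simp add: rad_power_def jac p(2))
  have unit: "a \<in> Units \<O>" if a: "a \<in> carrier \<O>" "a \<notin> J" for a
  proof (rule ccontr)
    assume nonunit: "a \<notin> Units \<O>"
    obtain M where "maximalideal M \<O>" "a \<in> M"
      by (rule exists_maximalideal[OF principal a(1) nonunit])
    then show False using unique a(2) by blast
  qed
  have unit_or: "a \<in> Units \<O> \<or> (\<exists>b\<in>carrier \<O>. a = p \<otimes>\<^bsub>\<O>\<^esub> b)" if "a \<in> carrier \<O>" for a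
  proof (cases "a \<in> J")
    case True
    then obtain b where "b \<in> carrier \<O>" "a = b \<otimes>\<^bsub>\<O>\<^esub> p"
      unfolding p(2) by (auto simp: cgenideal_def)
    then show ?thesis using p(1) m_comm by blast
  qed (use unit that in blast)
  obtain K where K: "subfield K \<O>" "finite_dimension K (carrier \<O>)"
    by (rule finite_dimension_scalars)
  obtain m where "p [^]\<^bsub>\<O>\<^esub> m \<in> PIdl\<^bsub>\<O>\<^esub> (p [^]\<^bsub>\<O>\<^esub> Suc m)"
    by (rule power_chain_stops[OF K p(1)])
  then obtain c where c: "c \<in> carrier \<O>" "p [^]\<^bsub>\<O>\<^esub> m = c \<otimes>\<^bsub>\<O>\<^esub> p [^]\<^bsub>\<O>\<^esub> Suc m"
    by (auto simp: cgenideal_def)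
  let ?u = "\<one>\<^bsub>\<O>\<^esub> \<ominus>\<^bsub>\<O>\<^esub> c \<otimes>\<^bsub>\<O>\<^esub> p"
  have u: "?u \<in> carrier \<O>" using c(1) p(1) by simp
  have "?u \<notin> J"
  proof
    assume "?u \<in> J"
    moreover have "c \<otimes>\<^bsub>\<O>\<^esub> p \<in> J"
      unfolding p(2) using c(1) p(1)
      by (intro ideal.I_l_closed cgenideal_ideal cgenideal_self)
    ultimately have "?u \<oplus>\<^bsub>\<O>\<^esub> c \<otimes>\<^bsub>\<O>\<^esub> p \<in> J" by (rule J.a_closed)
    then show False
      using one_notin one_minus_add[of "c \<otimes>\<^bsub>\<O>\<^esub> p"] c(1) p(1) by simp
  qed
  then have unit_u: "?u \<in> Units \<O>" using unit[OF u] by blast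
  have "p [^]\<^bsub>\<O>\<^esub> m = \<zero>\<^bsub>\<O>\<^esub>"
    by (rule power_eq_zero[OF p(1) c(1) unit_u c(2)])
  have rad_zero: "rad_power \<O> n = {\<zero>\<^bsub>\<O>\<^esub>} \<longleftrightarrow> p [^]\<^bsub>\<O>\<^esub> n = \<zero>\<^bsub>\<O>\<^esub>" for n
  proof
    assume "rad_power \<O> n = {\<zero>\<^bsub>\<O>\<^esub>}"
    then show "p [^]\<^bsub>\<O>\<^esub> n = \<zero>\<^bsub>\<O>\<^esub>"
      using cgenideal_self[of "p [^]\<^bsub>\<O>\<^esub> n"] p(1) by (simp add: rad)
  next
    assume "p [^]\<^bsub>\<O>\<^esub> n = \<zero>\<^bsub>\<O>\<^esub>"
    moreover have "PIdl\<^bsub>\<O>\<^esub> \<zero>\<^bsub>\<O>\<^esub> = {\<zero>\<^bsub>\<O>\<^esub>}"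
      by (simp add: cgenideal_eq_genideal genideal_zero)
    ultimately show "rad_power \<O> n = {\<zero>\<^bsub>\<O>\<^esub>}" by (simp add: rad)
  qed
  \<comment> \<open>The exponent \<open>m\<close> found above is the witness that makes
    \<open>LEAST\<close> meaningful.\<close>
  have least: "p [^]\<^bsub>\<O>\<^esub> loewy_length \<O> = \<zero>\<^bsub>\<O>\<^esub>"
    unfolding loewy_length_def rad_zero by (rule LeastI) fact
  have nonzero: "p [^]\<^bsub>\<O>\<^esub> k \<noteq> \<zero>\<^bsub>\<O>\<^esub>" if "k < loewy_length \<O>" for k
    using that unfolding loewy_length_def rad_zero by (rule not_less_Least)
  have "0 < loewy_length \<O>"
  proof (rule ccontr)
    assume "\<not> 0 < loewy_length \<O>"
    then have "\<one>\<^bsub>\<O>\<^esub> = \<zero>\<^bsub>\<O>\<^esub>" using least by simp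
    then show False using one_notin J.zero_closed by simp
  qed
  show thesis
    by (rule that[OF p(1) rad unit_or least nonzero \<open>0 < loewy_length \<O>\<close>])
qed

text \<open>The partial sums of \<open>h\<close> are positive, at most the Loewy length, and end at
  it, as \<open>uniserial_sum\<close> demands of its exponents.\<close>

lemma idempotent_levels_chain_alg:
  assumes pos: "\<And>i. i \<in> {1..s} \<Longrightarrow> 0 < h i" and sum: "(\<Sum>i = 1..s. h i) = loewy_length \<O>"
  shows "ring (chain_alg \<O> s h)"
    and "idempotent_levels (chain_alg \<O> s h) - {0} = partial_sum h ` {1..s}"
proof -
  obtain p where p: "p \<in> carrier \<O>" "\<And>n. rad_power \<O> n = PIdl\<^bsub>\<O>\<^esub> (p [^]\<^bsub>\<O>\<^esub> n)"
    "\<And>a. a \<in> carrier \<O> \<Longrightarrow> a \<in> Units \<O> \<or> (\<exists>b\<in>carrier \<O>. a = p \<otimes>\<^bsub>\<O>\<^esub> b)"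
    "p [^]\<^bsub>\<O>\<^esub> loewy_length \<O> = \<zero>\<^bsub>\<O>\<^esub>"
    "\<And>k. k < loewy_length \<O> \<Longrightarrow> p [^]\<^bsub>\<O>\<^esub> k \<noteq> \<zero>\<^bsub>\<O>\<^esub>"
    "0 < loewy_length \<O>"
    using uniformizer by blast
  \<comment> \<open>An empty sum would make the Loewy length zero.\<close>
  have "s \<noteq> 0" using p(6) sum by (metis atLeastatMost_empty_iff2 less_numeral_extra(3) not_one_le_zero sum.empty)
  interpret uniserial_sum \<O> s "\<lambda>i. rad_power \<O> (partial_sum h i)" p "loewy_length \<O>" "partial_sum h"
  proof (intro uniserial_sum.intro quotient_sum.intro quotient_sum_axioms.intro
      uniserial_sum_axioms.intro M_cring)
    fix i assume i: "i \<in> {1..s}"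
    show "ideal (rad_power \<O> (partial_sum h i)) \<O>"
      using p(1) by (simp add: p(2) cgenideal_ideal)
    show "0 < partial_sum h i"
      using i pos by (auto simp: partial_sum_def intro!: sum_pos)
    show "partial_sum h i \<le> loewy_length \<O>"
      unfolding partial_sum_def sum[symmetric] using i by (intro sum_mono2) auto
  qed (use p \<open>s \<noteq> 0\<close> sum in \<open>auto simp: partial_sum_def\<close>)
  have "chain_alg \<O> s h = E"
    by (simp add: chain_alg_def chain_module_def qsum_def)
  then show "ring (chain_alg \<O> s h)"
    and "idempotent_levels (chain_alg \<O> s h) - {0} = partial_sum h ` {1..s}"
    using E.ring_axioms idempotent_levels_E by simp_all
qed

end

text \<open>An increasing function lists its image in sorted order, and a finite set has just one
  sorted list.\<close>

lemma strict_mono_image_eq: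
  fixes f f' :: "nat \<Rightarrow> nat"
  assumes f: "strict_mono_on {1..n} f" and f': "strict_mono_on {1..n} f'"
    and eq: "f ` {1..n} = f' ` {1..n}" and i: "i \<in> {1..n}"
  shows "f i = f' i"
proof -
  have *: "sorted_list_of_set (f ` {1..n}) = map f [1..<Suc n]"
    if "strict_mono_on {1..n} f" for f :: "nat \<Rightarrow> nat"
  proof -
    have "sorted (map f [1..<Suc n])"
      using that by (auto simp: sorted_wrt_map sorted_wrt_iff_nth_less strict_mono_on_def less_imp_le
          simp del: upt_Suc)
    moreover have "distinct (map f [1..<Suc n])"
      using strict_mono_on_imp_inj_on[OF that] by (simp add: distinct_map atLeastLessThanSuc_atLeastAtMost del: upt_Suc)
    ultimately show ?thesis
      using sorted_list_of_set.idem_if_sorted_distinct[of "map f [1..<Suc n]"]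
      by (simp add: atLeastLessThanSuc_atLeastAtMost del: upt_Suc)
  qed
  have "map f [1..<Suc n] = map f' [1..<Suc n]"
    using *[OF f] *[OF f'] eq by simp
  then show ?thesis
    using i by (simp add: map_eq_conv del: upt_Suc)
qed

text \<open>The levels give the set of partial sums, strict monotonicity puts this set in order, and
  differences of consecutive partial sums are the entries.\<close>

lemma (in fd_local_principal_algebra) chain_alg_iso_imp_eq:
  assumes f: "f \<in> ring_iso (chain_alg \<O> s h) (chain_alg \<O> s h')"
    and pos: "\<And>i. i \<in> {1..s} \<Longrightarrow> 0 < h i" and sum: "(\<Sum>i = 1..s. h i) = loewy_length \<O>"
    and pos': "\<And>i. i \<in> {1..s} \<Longrightarrow> 0 < h' i" and sum': "(\<Sum>i = 1..s. h' i) = loewy_length \<O>"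
    and i: "i \<in> {1..s}"
  shows "h i = h' i"
proof -
  have mono: "strict_mono_on {1..s} (partial_sum h)" if "\<And>i. i \<in> {1..s} \<Longrightarrow> 0 < h i" for h
  proof (rule strict_mono_onI)
    fix a b assume ab: "a \<in> {1..s}" "b \<in> {1..s}" "a < b"
    have "partial_sum h b = partial_sum h a + (\<Sum>j = Suc a..b. h j)"
    proof -
      have "{1..b} = {1..a} \<union> {Suc a..b}" using ab by auto
      then show ?thesis by (simp add: partial_sum_def sum.union_disjoint)
    qed
    moreover have "0 < (\<Sum>j = Suc a..b. h j)"
      using ab that by (intro sum_pos) auto
    ultimately show "partial_sum h a < partial_sum h b" by simp
  qed
  have "partial_sum h ` {1..s} = partial_sum h' ` {1..s}"
    using idempotent_levels_chain_alg[OF pos sum] idempotent_levels_chain_alg[OF pos' sum']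
      idempotent_levels_iso[OF f] by simp
  then have eq: "partial_sum h j = partial_sum h' j" if "j \<in> {1..s}" for j
    using strict_mono_image_eq[OF mono[OF pos] mono[OF pos'] _ that] by simp
  \<comment> \<open>For \<open>i = 1\<close> the index falls outside \<open>{1..s}\<close>, and both
    sides are empty sums.\<close>
  have "partial_sum h (i - 1) = partial_sum h' (i - 1)"
    using eq[of "i - 1"] i by (cases "i = 1") (auto simp: partial_sum_def Suc_le_eq)
  moreover have "partial_sum h i = partial_sum h (i - 1) + h i" for h
    using i by (cases i) (auto simp: partial_sum_def)
  ultimately show ?thesis using eq[OF i] by simp
qed

section \<open>Coxeter length and stabilizer cosets\<close>

definition inversions :: "nat \<Rightarrow> (nat \<Rightarrow> nat) \<Rightarrow> (nat \<times> nat) set" where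
  "inversions s w = {(a, b). 1 \<le> a \<and> a < b \<and> b \<le> s \<and> w b < w a}"

lemma simple_refl_Sym: "i \<in> {1..<s} \<Longrightarrow> simple_refl i \<in> Sym s"
  by (auto simp: simple_refl_def sym_group_carrier intro!: permutes_swap_id)

lemma simple_refl_involutive [simp]: "simple_refl i (simple_refl i a) = a"
  by (simp add: simple_refl_def)

lemma simple_refl_comp [simp]: "simple_refl i \<circ> simple_refl i = id" "w \<circ> simple_refl i \<circ> simple_refl i = w"
  by (auto simp: fun_eq_iff)

lemma simple_refl_apply [simp]: "simple_refl i i = Suc i" "simple_refl i (Suc i) = i"
  by (simp_all add: simple_refl_def)

lemma simple_refl_less:
  assumes "a < b" "(a, b) \<noteq> (i, Suc i)"
  shows "simple_refl i a < simple_refl i b"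
  using assms by (auto simp: simple_refl_def transpose_def)

lemma simple_refl_bounds:
  assumes "i \<in> {1..<s}"
  shows "1 \<le> simple_refl i a \<longleftrightarrow> 1 \<le> a" "simple_refl i a \<le> s \<longleftrightarrow> a \<le> s"
  using assms by (auto simp: simple_refl_def transpose_def)

lemma finite_inversions: "finite (inversions s w)"
  by (rule finite_subset[of _ "{1..s} \<times> {1..s}"]) (auto simp: inversions_def)

text \<open>\<open>simple_refl i\<close> keeps the order of every pair of positions except
  \<open>(i, Suc i)\<close>. So it carries the inversions of \<open>w\<close> to the inversions of
  the product other than that pair, which an ascent turns into a new inversion.\<close>

lemma card_inversions_ascent:
  assumes i: "i \<in> {1..<s}" and asc: "w i < w (Suc i)"
  shows "card (inversions s (w \<circ> simple_refl i)) = card (inversions s w) + 1"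
proof -
  let ?\<sigma> = "simple_refl i"
  have "inversions s (w \<circ> ?\<sigma>) = insert (i, Suc i) (map_prod ?\<sigma> ?\<sigma> ` inversions s w)" (is "?L = ?R")
  proof
    show "?L \<subseteq> ?R"
    proof (clarify)
      fix a b assume ab: "(a, b) \<in> ?L" "(a, b) \<notin> map_prod ?\<sigma> ?\<sigma> ` inversions s w"
      show "a = i \<and> b = Suc i"
      proof (rule ccontr)
        assume "\<not> (a = i \<and> b = Suc i)"
        then have "(?\<sigma> a, ?\<sigma> b) \<in> inversions s w"
          using ab(1) simple_refl_less[of a b i] simple_refl_bounds[OF i] by (auto simp: inversions_def)
        then have "(a, b) \<in> map_prod ?\<sigma> ?\<sigma> ` inversions s w"
          by (intro image_eqI[of _ _ "(?\<sigma> a, ?\<sigma> b)"]) auto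
        then show False using ab(2) by simp
      qed
    qed
    have "(?\<sigma> c, ?\<sigma> d) \<in> ?L" if cd: "(c, d) \<in> inversions s w" for c d
    proof -
      have "(c, d) \<noteq> (i, Suc i)" using cd asc by (auto simp: inversions_def)
      then show ?thesis
        using cd simple_refl_less[of c d i] simple_refl_bounds[OF i] by (simp add: inversions_def)
    qed
    then show "?R \<subseteq> ?L"
      using i asc by (auto simp: inversions_def)
  qed
  moreover have "(i, Suc i) \<notin> map_prod ?\<sigma> ?\<sigma> ` inversions s w"
  proof
    assume "(i, Suc i) \<in> map_prod ?\<sigma> ?\<sigma> ` inversions s w"
    then obtain c d where cd: "(c, d) \<in> inversions s w" "i = ?\<sigma> c" "Suc i = ?\<sigma> d" by auto
    then have "c = Suc i" "d = i" by (metis simple_refl_apply simple_refl_involutive)+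
    then show False using cd(1) by (simp add: inversions_def)
  qed
  moreover have "inj_on (map_prod ?\<sigma> ?\<sigma>) (inversions s w)"
    by (rule inj_onI) (metis map_prod_simp prod.collapse prod.inject simple_refl_involutive)
  ultimately show ?thesis
    by (simp add: card_image finite_inversions)
qed

lemma Sym_inj: "w \<in> Sym s \<Longrightarrow> w a = w b \<longleftrightarrow> a = b"
  by (simp add: sym_group_carrier permutes_inj inj_eq)

lemma Sym_comp: "v \<in> Sym s \<Longrightarrow> w \<in> Sym s \<Longrightarrow> v \<circ> w \<in> Sym s"
  by (simp add: sym_group_carrier permutes_compose)

lemma Sym_mem: "w \<in> Sym s \<Longrightarrow> w a \<in> {1..s} \<longleftrightarrow> a \<in> {1..s}"
  using permutes_in_image[of w "{1..s}" a] by (simp add: sym_group_carrier)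

lemma card_inversions_descent:
  assumes i: "i \<in> {1..<s}" and desc: "w (Suc i) < w i"
  shows "card (inversions s w) = card (inversions s (w \<circ> simple_refl i)) + 1"
  using card_inversions_ascent[OF i, of "w \<circ> simple_refl i"] desc by simp

definition word_prod :: "nat list \<Rightarrow> nat \<Rightarrow> nat" where
  "word_prod is = foldr (\<lambda>i v. simple_refl i \<circ> v) is id"

lemma word_prod_Nil: "word_prod [] = id"
  by (simp add: word_prod_def fun_eq_iff)

lemma inversions_id: "inversions s id = {}"
  by (auto simp: inversions_def)

lemma id_Sym: "id \<in> Sym s"
  unfolding sym_group_carrier by (rule permutes_id)

text \<open>\<open>foldr\<close> attaches letters on the left, whereas inversions are controlled
  under multiplication on the right; words are therefore extended at their end.\<close>

lemma word_prod_snoc: "word_prod (is @ [i]) = word_prod is \<circ> simple_refl i"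
proof -
  have "foldr (\<lambda>i v. simple_refl i \<circ> v) is u = word_prod is \<circ> u" for u
    by (induction "is") (auto simp: word_prod_def)
  from this[of "simple_refl i"] show ?thesis by (simp add: word_prod_def)
qed

text \<open>By the ascent and descent lemmas, each letter raises the number of inversions by at most
  one.\<close>

lemma card_inversions_word:
  "set is \<subseteq> {1..<s} \<Longrightarrow> word_prod is \<in> Sym s \<and> card (inversions s (word_prod is)) \<le> length is"
proof (induction "is" rule: rev_induct)
  case Nil
  show ?case unfolding word_prod_Nil inversions_id by (intro conjI id_Sym) simp
next
  case (snoc i "is")
  then have w: "word_prod is \<in> Sym s" "card (inversions s (word_prod is)) \<le> length is" and i: "i \<in> {1..<s}"
    by auto
  have "word_prod is i \<noteq> word_prod is (Suc i)" using Sym_inj[OF w(1)] by simp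
  then have "card (inversions s (word_prod is \<circ> simple_refl i)) \<le> length is + 1"
    using card_inversions_ascent[OF i, of "word_prod is"] card_inversions_descent[OF i, of "word_prod is"] w(2)
    by linarith
  then show ?case
    using Sym_comp[OF w(1) simple_refl_Sym[OF i]] by (simp add: word_prod_snoc comp_def)
qed

text \<open>Such a \<open>w\<close> is increasing on all of \<open>{1..s}\<close> and has the same
  image there as \<open>id\<close>.\<close>

lemma no_descent_imp_id:
  assumes w: "w \<in> Sym s" and asc: "\<And>i. i \<in> {1..<s} \<Longrightarrow> w i < w (Suc i)"
  shows "w = id"
proof
  have "strict_mono_on {1..s} w"
  proof (rule strict_mono_onI)
    fix a b assume ab: "a \<in> {1..s}" "b \<in> {1..s}" "a < b"
    from \<open>a < b\<close> have "Suc a \<le> b" by simp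
    then have "b \<le> s \<longrightarrow> w a < w b"
    proof (induction b rule: dec_induct)
      case base
      then show ?case using asc[of a] ab(1) by auto
    next
      case (step n)
      then show ?case using asc[of n] ab(1) by auto
    qed
    then show "w a < w b" using ab by simp
  qed
  moreover have "strict_mono_on {1..s} id" by (simp add: strict_mono_on_def)
  moreover have "w ` {1..s} = id ` {1..s}"
    using w by (simp add: sym_group_carrier permutes_image)
  ultimately show "w i = id i" for i
    using strict_mono_image_eq[of s w id i] w by (cases "i \<in> {1..s}") (auto simp: sym_group_carrier permutes_not_in)
qed

text \<open>Bubble sort: one reflection at a descent removes exactly one inversion, until no descent
  is left and the identity remains.\<close>

lemma ex_word:
  "w \<in> Sym s \<Longrightarrow> \<exists>is. length is = card (inversions s w) \<and> set is \<subseteq> {1..<s} \<and> w = word_prod is"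
proof (induction "card (inversions s w)" arbitrary: w rule: less_induct)
  case less
  show ?case
  proof (cases "\<exists>i\<in>{1..<s}. w (Suc i) < w i")
    case True
    then obtain i where i: "i \<in> {1..<s}" "w (Suc i) < w i" by blast
    note c = card_inversions_descent[OF i]
    have "w \<circ> simple_refl i \<in> Sym s"
      using less(2) simple_refl_Sym[OF i(1)] by (rule Sym_comp)
    then obtain "is" where w: "length is = card (inversions s (w \<circ> simple_refl i))"
        "set is \<subseteq> {1..<s}" "w \<circ> simple_refl i = word_prod is"
      using less(1)[of "w \<circ> simple_refl i"] c by auto
    have "w = word_prod (is @ [i])"
      unfolding word_prod_snoc w(3)[symmetric] by simp
    moreover have "length (is @ [i]) = card (inversions s w)" "set (is @ [i]) \<subseteq> {1..<s}"
      using c w(1,2) i(1) by simp_all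
    ultimately show ?thesis by blast
  next
    case False
    have "w i < w (Suc i)" if "i \<in> {1..<s}" for i
    proof -
      have "w i \<noteq> w (Suc i)" using Sym_inj[OF less(2)] by simp
      then show ?thesis using False that by (meson linorder_neqE_nat)
    qed
    then have "w = id" by (rule no_descent_imp_id[OF less(2)])
    then have "length [] = card (inversions s w) \<and> set [] \<subseteq> {1..<s} \<and> w = word_prod []"
      by (simp only: word_prod_Nil inversions_id) simp
    then show ?thesis by blast
  qed
qed

lemma coxeter_length_eq:
  assumes "w \<in> Sym s"
  shows "coxeter_length s w = card (inversions s w)"
  unfolding coxeter_length_def word_prod_def[symmetric]
proof (rule Least_equality)
  show "\<exists>is. length is = card (inversions s w) \<and> set is \<subseteq> {1..<s} \<and> w = word_prod is"
    by (rule ex_word[OF assms])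
  fix n assume "\<exists>is. length is = n \<and> set is \<subseteq> {1..<s} \<and> w = word_prod is"
  then show "card (inversions s w) \<le> n" using card_inversions_word by blast
qed

lemma coxeter_length_ascent_iff:
  assumes w: "w \<in> Sym s" and i: "i \<in> {1..<s}"
  shows "coxeter_length s (w \<circ> simple_refl i) = coxeter_length s w + 1 \<longleftrightarrow> w i < w (Suc i)"
proof -
  have "w i \<noteq> w (Suc i)" using Sym_inj[OF w] by simp
  then show ?thesis
    using card_inversions_ascent[OF i, of w] card_inversions_descent[OF i, of w]
      coxeter_length_eq[OF w] coxeter_length_eq[OF Sym_comp[OF w simple_refl_Sym[OF i]]]
    by linarith
qed

section \<open>The stabilizer of a tuple and its right cosets\<close>

lemma stabD: "h \<in> stab s g \<Longrightarrow> h \<in> Sym s" "h \<in> stab s g \<Longrightarrow> g (h j) = g j"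
proof -
  assume h: "h \<in> stab s g"
  then show "h \<in> Sym s" by (simp add: stab_def)
  then show "g (h j) = g j"
    using h by (cases "j \<in> {1..s}") (auto simp: stab_def sym_group_carrier permutes_not_in)
qed

lemma stabI: "h \<in> Sym s \<Longrightarrow> (\<And>j. j \<in> {1..s} \<Longrightarrow> g (h j) = g j) \<Longrightarrow> h \<in> stab s g"
  by (simp add: stab_def)

lemma subgroup_stab: "subgroup (stab s g) (sym_group s)"
proof -
  interpret group "sym_group s" by (rule sym_group_is_group)
  show ?thesis
  proof (rule subgroupI)
    show "stab s g \<noteq> {}"
      using stabI[of id s g] by (auto simp: sym_group_carrier permutes_id)
    fix h assume h: "h \<in> stab s g"
    have "g (inv' h j) = g j" for j
      using stabD(2)[OF h, of "inv' h j"] stabD(1)[OF h]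
      by (simp add: sym_group_carrier permutes_inverses)
    then show "inv\<^bsub>sym_group s\<^esub> h \<in> stab s g"
      using stabD(1)[OF h] by (intro stabI) (simp_all add: sym_group_inv_closed)
  next
    fix h h' assume "h \<in> stab s g" "h' \<in> stab s g"
    then show "h \<otimes>\<^bsub>sym_group s\<^esub> h' \<in> stab s g"
      by (intro stabI) (simp_all add: sym_group_mult stabD Sym_comp)
  qed (auto simp: stabD)
qed

lemma coset_eq: "stab s g #>\<^bsub>sym_group s\<^esub> w = {h \<circ> w | h. h \<in> stab s g}"
  by (auto simp: r_coset_def sym_group_mult)

text \<open>The cosets are the fibres of \<open>w \<mapsto> g \<circ> w\<close>: two elements of a
  fibre differ on the left by \<open>v \<circ> inv' u\<close>, which fixes \<open>g\<close>.\<close>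

lemma mem_coset_iff:
  assumes u: "u \<in> Sym s" and v: "v \<in> Sym s"
  shows "v \<in> stab s g #>\<^bsub>sym_group s\<^esub> u \<longleftrightarrow> g \<circ> u = g \<circ> v"
proof
  assume "v \<in> stab s g #>\<^bsub>sym_group s\<^esub> u"
  then show "g \<circ> u = g \<circ> v" by (auto simp: coset_eq stabD)
next
  assume eq: "g \<circ> u = g \<circ> v"
  have inv: "inv' u \<in> Sym s" using u by (rule sym_group_inv_closed)
  have "g (v (inv' u j)) = g j" for j
    using fun_cong[OF eq, of "inv' u j"] u by (simp add: sym_group_carrier permutes_inverses)
  then have "v \<circ> inv' u \<in> stab s g"
    using Sym_comp[OF v inv] by (intro stabI) auto
  moreover have "v = (v \<circ> inv' u) \<circ> u"
    using u by (auto simp: fun_eq_iff sym_group_carrier permutes_inverses)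
  ultimately show "v \<in> stab s g #>\<^bsub>sym_group s\<^esub> u" by (auto simp: coset_eq)
qed

lemma coset_eq_iff:
  assumes u: "u \<in> Sym s" and v: "v \<in> Sym s"
  shows "stab s g #>\<^bsub>sym_group s\<^esub> u = stab s g #>\<^bsub>sym_group s\<^esub> v \<longleftrightarrow> g \<circ> u = g \<circ> v"
proof
  assume "stab s g #>\<^bsub>sym_group s\<^esub> u = stab s g #>\<^bsub>sym_group s\<^esub> v"
  then show "g \<circ> u = g \<circ> v" using mem_coset_iff[OF u v, of g] mem_coset_iff[OF v v, of g] by simp
next
  assume "g \<circ> u = g \<circ> v"
  then have "v \<in> stab s g #>\<^bsub>sym_group s\<^esub> u" using mem_coset_iff[OF u v] by simp
  then show "stab s g #>\<^bsub>sym_group s\<^esub> u = stab s g #>\<^bsub>sym_group s\<^esub> v"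
    by (rule group.repr_independence[OF sym_group_is_group _ u subgroup_stab])
qed

lemma coset_subset: "w \<in> Sym s \<Longrightarrow> stab s g #>\<^bsub>sym_group s\<^esub> w \<subseteq> Sym s"
  by (auto simp: coset_eq intro: Sym_comp stabD)

lemma coset_mult_simple_refl:
  "(stab s g #>\<^bsub>sym_group s\<^esub> w) #>\<^bsub>sym_group s\<^esub> simple_refl i =
     stab s g #>\<^bsub>sym_group s\<^esub> (w \<circ> simple_refl i)"
  by (auto simp: r_coset_def sym_group_mult comp_assoc)

section \<open>The quotient of the mutation graph\<close>

text \<open>The graph arguments see the modules only through the injectivity of
  \<open>w \<mapsto> tilt s T w\<close>, which lets vertices be treated as permutations.\<close>

locale injective_tilts =
  fixes s :: nat and g :: "nat \<Rightarrow> nat" and T :: "(nat \<Rightarrow> nat) \<Rightarrow> nat \<Rightarrow> ('b, 'm) module"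
  assumes inj: "inj_on (tilt s T) (Sym s)"
begin

abbreviation "\<tau> \<equiv> tilt s T"
abbreviation "C w \<equiv> stab s g #>\<^bsub>sym_group s\<^esub> w"
abbreviation "Q \<equiv> mutation_quotient s g T"
abbreviation "edge_orbit i w \<equiv> orbit (stab_group s g) (edge_act s T) (mutation_edge s T i w)"

lemma tilt_eq_iff: "u \<in> Sym s \<Longrightarrow> v \<in> Sym s \<Longrightarrow> \<tau> u = \<tau> v \<longleftrightarrow> u = v"
  using inj by (rule inj_on_eq_iff)

lemma vertex_act_tilt: "w \<in> Sym s \<Longrightarrow> vertex_act s T h (\<tau> w) = \<tau> (h \<circ> w)"
  by (simp add: vertex_act_def inv_into_f_f[OF inj])

lemma vertex_orbit: "w \<in> Sym s \<Longrightarrow> orbit (stab_group s g) (vertex_act s T) (\<tau> w) = \<tau> ` C w"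
  by (auto simp: orbit_def vertex_act_tilt coset_eq)

lemma edge_act_mutation_edge:
  assumes "w \<in> Sym s" "i \<in> {1..<s}"
  shows "edge_act s T h (mutation_edge s T i w) = mutation_edge s T i (h \<circ> w)"
  using assms Sym_comp[OF assms(1) simple_refl_Sym[OF assms(2)]]
  by (simp add: edge_act_def mutation_edge_def vertex_act_tilt comp_assoc)

lemma edge_orbit_eq:
  assumes "w \<in> Sym s" "i \<in> {1..<s}"
  shows "edge_orbit i w = mutation_edge s T i ` C w"
  using assms by (auto simp: orbit_def edge_act_mutation_edge coset_eq)

lemma coset_self: "w \<in> Sym s \<Longrightarrow> w \<in> C w"
  by (simp add: mem_coset_iff)

lemma coset_refl_cong:
  assumes "u \<in> Sym s" "v \<in> C u" "i \<in> {1..<s}"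
  shows "C (v \<circ> simple_refl i) = C (u \<circ> simple_refl i)" "C v = C u"
proof -
  have v: "v \<in> Sym s" using assms(1,2) coset_subset by blast
  have eq: "g \<circ> u = g \<circ> v" using assms(2) mem_coset_iff[OF assms(1) v] by simp
  then show "C v = C u" using coset_eq_iff[OF v assms(1)] by simp
  have "g \<circ> (v \<circ> simple_refl i) = g \<circ> (u \<circ> simple_refl i)"
    using eq by (simp flip: comp_assoc)
  then show "C (v \<circ> simple_refl i) = C (u \<circ> simple_refl i)"
    using coset_eq_iff[OF Sym_comp[OF v simple_refl_Sym[OF assms(3)]]
        Sym_comp[OF assms(1) simple_refl_Sym[OF assms(3)]]] by simp
qed

lemma lends_Q:
  "lends Q \<epsilon> = (\<Union>e\<in>\<epsilon>. orbit (stab_group s g) (vertex_act s T) ` lends (mutation_graph s T) e)"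
  unfolding mutation_quotient_def quotient_lgraph_def lgraph.select_convs by blast

lemma lends_edge_orbit:
  assumes w: "w \<in> Sym s" and i: "i \<in> {1..<s}"
  shows "lends Q (edge_orbit i w) = {\<tau> ` C w, \<tau> ` C (w \<circ> simple_refl i)}"
proof -
  \<comment> \<open>All lifts of a quotient edge have the same end orbits, so the union over the
    lifts collapses to one pair.\<close>
  have orb: "orbit (stab_group s g) (vertex_act s T) ` lends (mutation_graph s T) (mutation_edge s T i v)
      = {\<tau> ` C w, \<tau> ` C (w \<circ> simple_refl i)}" if v: "v \<in> C w" for v
  proof -
    have vS: "v \<in> Sym s" using v w coset_subset by blast
    show ?thesis
      using vertex_orbit[OF vS] vertex_orbit[OF Sym_comp[OF vS simple_refl_Sym[OF i]]]
        coset_refl_cong[OF w v i]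
      by (simp add: mutation_graph_def mutation_edge_def)
  qed
  have "lends Q (edge_orbit i w) =
      (\<Union>v\<in>C w. orbit (stab_group s g) (vertex_act s T) `
        lends (mutation_graph s T) (mutation_edge s T i v))"
    unfolding lends_Q edge_orbit_eq[OF w i] by blast
  also have "\<dots> = (\<Union>v\<in>C w. {\<tau> ` C w, \<tau> ` C (w \<circ> simple_refl i)})"
    by (intro SUP_cong refl orb)
  also have "\<dots> = {\<tau> ` C w, \<tau> ` C (w \<circ> simple_refl i)}"
    using coset_self[OF w] by blast
  finally show ?thesis .
qed

lemma llabel_edge_orbit:
  assumes w: "w \<in> Sym s" and i: "i \<in> {1..<s}"
  shows "llabel Q (edge_orbit i w) = i"
proof -
  have "fst ` edge_orbit i w = {i}"
    unfolding edge_orbit_eq[OF w i] image_image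
    using coset_self[OF w] by (simp add: mutation_edge_def image_constant)
  then show ?thesis by (simp add: mutation_quotient_def quotient_lgraph_def mutation_graph_def)
qed

lemma lverts_Q: "lverts Q = (\<lambda>w. \<tau> ` C w) ` Sym s"
proof -
  have "lverts Q = (\<lambda>w. orbit (stab_group s g) (vertex_act s T) (\<tau> w)) ` Sym s"
    by (auto simp: mutation_quotient_def quotient_lgraph_def mutation_graph_def orbits_def)
  also have "\<dots> = (\<lambda>w. \<tau> ` C w) ` Sym s"
    by (intro image_cong refl vertex_orbit)
  finally show ?thesis .
qed

lemma ledges_Q: "ledges Q = {edge_orbit i w | i w. i \<in> {1..<s} \<and> w \<in> Sym s}"
  unfolding mutation_quotient_def quotient_lgraph_def mutation_graph_def orbits_def
    lgraph.select_convs by blast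

lemma image_tilt_coset_iff:
  assumes "u \<in> Sym s" "v \<in> Sym s"
  shows "\<tau> ` C u = \<tau> ` C v \<longleftrightarrow> C u = C v"
  using inj_on_image_eq_iff[OF inj coset_subset[OF assms(1)] coset_subset[OF assms(2)]] .

text \<open>An undirected edge has two names, \<open>w\<close> and
  \<open>w \<circ> simple_refl i\<close>. Matching ends thus leaves two cases, equal cosets or
  cosets matched crosswise, and the crossed case is settled by renaming.\<close>

lemma edge_orbit_eq_iff:
  assumes u: "u \<in> Sym s" and v: "v \<in> Sym s" and i: "i \<in> {1..<s}"
  shows "edge_orbit i u = edge_orbit i v \<longleftrightarrow>
    {C u, C (u \<circ> simple_refl i)} = {C v, C (v \<circ> simple_refl i)}"
proof
  have us: "u \<circ> simple_refl i \<in> Sym s" and vs: "v \<circ> simple_refl i \<in> Sym s"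
    using u v simple_refl_Sym[OF i] by (auto intro: Sym_comp)
  {
    assume "edge_orbit i u = edge_orbit i v"
    then have "{\<tau> ` C u, \<tau> ` C (u \<circ> simple_refl i)} = {\<tau> ` C v, \<tau> ` C (v \<circ> simple_refl i)}"
      using lends_edge_orbit[OF u i] lends_edge_orbit[OF v i] by simp
    then show "{C u, C (u \<circ> simple_refl i)} = {C v, C (v \<circ> simple_refl i)}"
      unfolding doubleton_eq_iff
      using image_tilt_coset_iff u v us vs by blast
  next
    assume "{C u, C (u \<circ> simple_refl i)} = {C v, C (v \<circ> simple_refl i)}"
    then consider "C u = C v" | "C u = C (v \<circ> simple_refl i)"
      by (auto simp: doubleton_eq_iff)
    then show "edge_orbit i u = edge_orbit i v"
    proof cases
      case 1
      then show ?thesis unfolding edge_orbit_eq[OF u i] edge_orbit_eq[OF v i] by simp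
    next
      case 2
      have sym: "mutation_edge s T i (w \<circ> simple_refl i) = mutation_edge s T i w" for w
        by (simp add: mutation_edge_def insert_commute)
      have "C (v \<circ> simple_refl i) = (\<lambda>w. w \<circ> simple_refl i) ` C v"
        unfolding coset_eq comp_assoc[symmetric] by blast
      then show ?thesis
        unfolding edge_orbit_eq[OF u i] edge_orbit_eq[OF v i] 2 by (simp add: image_image sym)
    qed
  }
qed

text \<open>The Schreier graph forms orbits by iteration; as the reflection is an involution, the
  iterates alternate between two cosets.\<close>

lemma simple_refl_coset_orbit:
  "{((\<lambda>Y. Y #>\<^bsub>sym_group s\<^esub> simple_refl i) ^^ n) (C w) | n. True} = {C w, C (w \<circ> simple_refl i)}"
    (is "?L = ?R")
proof -
  let ?f = "\<lambda>Y. Y #>\<^bsub>sym_group s\<^esub> simple_refl i"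
  have f: "?f (C w) = C (w \<circ> simple_refl i)" "?f (C (w \<circ> simple_refl i)) = C w"
    unfolding coset_mult_simple_refl simple_refl_comp by (rule refl)+
  have "(?f ^^ n) (C w) = C w \<or> (?f ^^ n) (C w) = C (w \<circ> simple_refl i)" for n
  proof (induction n)
    case 0
    show ?case by simp
  next
    case (Suc n)
    have *: "(?f ^^ Suc n) (C w) = ?f ((?f ^^ n) (C w))" by simp
    from Suc show ?case unfolding * by (elim disjE) (simp_all only: f simp_thms)
  qed
  then have "?L \<subseteq> ?R" by blast
  moreover have "C w \<in> ?L" by (rule CollectI, rule exI[of _ 0]) simp
  moreover have "C (w \<circ> simple_refl i) \<in> ?L"
    by (rule CollectI, rule exI[of _ 1]) (simp only: f One_nat_def funpow.simps comp_apply id_apply simp_thms)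
  ultimately show ?thesis by blast
qed

lemma schreier_edges:
  "ledges (schreier_graph s (stab s g)) =
     {(i, {C w, C (w \<circ> simple_refl i)}) | i w. i \<in> {1..<s} \<and> w \<in> Sym s}"
proof -
  have "ledges (schreier_graph s (stab s g)) =
      {(i, {((\<lambda>Y. Y #>\<^bsub>sym_group s\<^esub> simple_refl i) ^^ n) (C w) | n. True}) | i w.
        i \<in> {1..<s} \<and> w \<in> Sym s}"
    unfolding schreier_graph_def RCOSETS_def lgraph.select_convs by blast
  then show ?thesis unfolding simple_refl_coset_orbit .
qed

lemma schreier_verts: "lverts (schreier_graph s (stab s g)) = C ` Sym s"
  by (auto simp: schreier_graph_def RCOSETS_def)

section \<open>The isomorphism with the Schreier graph\<close>

definition coset_of_orbit :: "('b, nat \<Rightarrow> 'm) module set \<Rightarrow> (nat \<Rightarrow> nat) set" where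
  "coset_of_orbit X = {w \<in> Sym s. \<tau> w \<in> X}"

lemma coset_of_orbit: "w \<in> Sym s \<Longrightarrow> coset_of_orbit (\<tau> ` C w) = C w"
  using coset_subset[of w s g] tilt_eq_iff by (auto simp: coset_of_orbit_def)

text \<open>Built from the label and the ends of the quotient edge, so that compatibility with both
  is immediate and only bijectivity needs an argument.\<close>

definition schreier_edge :: "(nat \<times> ('b, nat \<Rightarrow> 'm) module set) set \<Rightarrow> nat \<times> (nat \<Rightarrow> nat) set set" where
  "schreier_edge \<epsilon> = (llabel Q \<epsilon>, coset_of_orbit ` lends Q \<epsilon>)"

lemma schreier_edge_orbit:
  assumes w: "w \<in> Sym s" and i: "i \<in> {1..<s}"
  shows "schreier_edge (edge_orbit i w) = (i, {C w, C (w \<circ> simple_refl i)})"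
  using coset_of_orbit[OF w] coset_of_orbit[OF Sym_comp[OF w simple_refl_Sym[OF i]]]
  by (simp add: schreier_edge_def llabel_edge_orbit[OF w i] lends_edge_orbit[OF w i])

lemma quotient_iso_schreier:
  "lgraph_iso Q (schreier_graph s (stab s g)) coset_of_orbit schreier_edge"
  unfolding lgraph_iso_def
proof (intro conjI ballI)
  show "bij_betw coset_of_orbit (lverts Q) (lverts (schreier_graph s (stab s g)))"
  proof (rule bij_betw_imageI)
    show "inj_on coset_of_orbit (lverts Q)"
    proof (rule inj_onI)
      fix X Y assume "X \<in> lverts Q" "Y \<in> lverts Q" and eq: "coset_of_orbit X = coset_of_orbit Y"
      then obtain u v where "u \<in> Sym s" "X = \<tau> ` C u" "v \<in> Sym s" "Y = \<tau> ` C v"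
        unfolding lverts_Q by blast
      then show "X = Y" using eq by (simp add: coset_of_orbit)
    qed
    show "coset_of_orbit ` lverts Q = lverts (schreier_graph s (stab s g))"
      unfolding lverts_Q schreier_verts by (simp add: image_image coset_of_orbit)
  qed
  show "bij_betw schreier_edge (ledges Q) (ledges (schreier_graph s (stab s g)))"
  proof (rule bij_betw_imageI)
    show "inj_on schreier_edge (ledges Q)"
    proof (rule inj_onI)
      fix \<epsilon> \<delta> assume "\<epsilon> \<in> ledges Q" "\<delta> \<in> ledges Q" and eq: "schreier_edge \<epsilon> = schreier_edge \<delta>"
      then obtain i u j v where *: "\<epsilon> = edge_orbit i u" "i \<in> {1..<s}" "u \<in> Sym s"
          "\<delta> = edge_orbit j v" "j \<in> {1..<s}" "v \<in> Sym s"
        unfolding ledges_Q by blast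
      \<comment> \<open>The label component keeps parallel edges with different labels apart; for
        equal labels the end cosets determine the orbit.\<close>
      have eq': "(i, {C u, C (u \<circ> simple_refl i)}) = (j, {C v, C (v \<circ> simple_refl j)})"
        using eq unfolding *(1,4) schreier_edge_orbit[OF *(3,2)] schreier_edge_orbit[OF *(6,5)] .
      then have "i = j" by simp
      with eq' show "\<epsilon> = \<delta>"
        using edge_orbit_eq_iff[OF *(3,6,2)] *(1,4) by simp
    qed
    show "schreier_edge ` ledges Q = ledges (schreier_graph s (stab s g))"
    proof
      show "schreier_edge ` ledges Q \<subseteq> ledges (schreier_graph s (stab s g))"
        unfolding ledges_Q schreier_edges using schreier_edge_orbit by blast
      show "ledges (schreier_graph s (stab s g)) \<subseteq> schreier_edge ` ledges Q"
      proof
        fix e assume "e \<in> ledges (schreier_graph s (stab s g))"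
        then obtain i w where *: "i \<in> {1..<s}" "w \<in> Sym s" "e = (i, {C w, C (w \<circ> simple_refl i)})"
          unfolding schreier_edges by blast
        have "edge_orbit i w \<in> ledges Q" using * unfolding ledges_Q by blast
        then show "e \<in> schreier_edge ` ledges Q"
          by (rule rev_image_eqI) (simp only: schreier_edge_orbit[OF *(2,1)] *(3))
      qed
    qed
  qed
qed (simp_all add: schreier_edge_def schreier_graph_def)

section \<open>Loops and the weak order orientation\<close>

lemma card_doubleton_eq_1: "card {x, y} = 1 \<longleftrightarrow> x = y"
  by (cases "x = y") simp_all

text \<open>Both ends lie in one coset when exchanging the entries \<open>i\<close> and
  \<open>Suc i\<close> of \<open>g \<circ> w\<close> changes nothing.\<close>

lemma is_loop_iff:
  assumes w: "w \<in> Sym s" and i: "i \<in> {1..<s}"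
  shows "is_loop Q (edge_orbit i w) \<longleftrightarrow> g (w i) = g (w (Suc i))"
proof -
  have ws: "w \<circ> simple_refl i \<in> Sym s" using w simple_refl_Sym[OF i] by (rule Sym_comp)
  have "is_loop Q (edge_orbit i w) \<longleftrightarrow> \<tau> ` C w = \<tau> ` C (w \<circ> simple_refl i)"
    unfolding is_loop_def lends_edge_orbit[OF w i] by (rule card_doubleton_eq_1)
  also have "\<dots> \<longleftrightarrow> g \<circ> w = g \<circ> (w \<circ> simple_refl i)"
    unfolding image_tilt_coset_iff[OF w ws] coset_eq_iff[OF w ws] ..
  also have "\<dots> \<longleftrightarrow> g (w i) = g (w (Suc i))"
  proof
    assume "g \<circ> w = g \<circ> (w \<circ> simple_refl i)"
    from fun_cong[OF this, of i] show "g (w i) = g (w (Suc i))" by simp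
  next
    assume "g (w i) = g (w (Suc i))"
    then have "g (w a) = g (w (simple_refl i a))" for a
      by (simp add: simple_refl_def transpose_def)
    then show "g \<circ> w = g \<circ> (w \<circ> simple_refl i)" by (simp add: fun_eq_iff)
  qed
  finally show ?thesis .
qed

text \<open>By injectivity of \<open>\<tau>\<close> the arc can come only from \<open>u\<close>
  itself, so the length condition may be read off at \<open>u\<close>.\<close>

lemma arc_iff:
  assumes u: "u \<in> Sym s" and i: "i \<in> {1..<s}"
  shows "(\<tau> u, i, \<tau> (u \<circ> simple_refl i)) \<in> weak_order_arcs s T \<longleftrightarrow> u i < u (Suc i)"
proof -
  have "(\<tau> u, i, \<tau> (u \<circ> simple_refl i)) \<in> weak_order_arcs s T \<longleftrightarrow>
      coxeter_length s (u \<circ> simple_refl i) = coxeter_length s u + 1"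
    using u i tilt_eq_iff by (auto simp: weak_order_arcs_def)
  then show ?thesis using coxeter_length_ascent_iff[OF u i] by simp
qed

lemma arc_rev_iff:
  assumes u: "u \<in> Sym s" and i: "i \<in> {1..<s}"
  shows "(\<tau> (u \<circ> simple_refl i), i, \<tau> u) \<in> weak_order_arcs s T \<longleftrightarrow> u (Suc i) < u i"
  using arc_iff[OF Sym_comp[OF u simple_refl_Sym[OF i]] i] by simp

lemma orientation_descends_iff_monotone:
  "orientation_descends s g T \<longleftrightarrow>
     (\<forall>w\<in>Sym s. \<forall>i\<in>{1..<s}. g (w i) \<noteq> g (w (Suc i)) \<longrightarrow>
        (\<forall>h\<in>stab s g. h (w i) < h (w (Suc i))) \<or> (\<forall>h\<in>stab s g. h (w (Suc i)) < h (w i)))"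
proof -
  have "(\<forall>h\<in>stab s g. (\<tau> (h \<circ> w), i, \<tau> (h \<circ> w \<circ> simple_refl i)) \<in> weak_order_arcs s T) \<longleftrightarrow>
      (\<forall>h\<in>stab s g. h (w i) < h (w (Suc i)))"
    "(\<forall>h\<in>stab s g. (\<tau> (h \<circ> w \<circ> simple_refl i), i, \<tau> (h \<circ> w)) \<in> weak_order_arcs s T) \<longleftrightarrow>
      (\<forall>h\<in>stab s g. h (w (Suc i)) < h (w i))"
    if "w \<in> Sym s" "i \<in> {1..<s}" for w i
    using arc_iff[OF Sym_comp[OF stabD(1) that(1)] that(2)]
      arc_rev_iff[OF Sym_comp[OF stabD(1) that(1)] that(2)] by (auto intro!: ball_cong)
  then show ?thesis
    unfolding orientation_descends_def by (intro ball_cong refl) (simp add: is_loop_iff)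
qed

lemma orientation_descends_iff:
  "orientation_descends s g T \<longleftrightarrow> (\<forall>a\<in>g ` {1..s}. is_interval (level_set s g a))"
proof
  assume int: "\<forall>a\<in>g ` {1..s}. is_interval (level_set s g a)"
  \<comment> \<open>Stabilizer elements keep each point in its level set, and two disjoint intervals
    are ordered as wholes.\<close>
  have mono: "h a < h b" if ab: "a \<in> {1..s}" "b \<in> {1..s}" "g a \<noteq> g b" "a < b" and h: "h \<in> stab s g" for a b h
  proof -
    obtain m n where mn: "level_set s g (g a) = {m..n}"
      using int ab(1) unfolding is_interval_def by blast
    obtain m' n' where mn': "level_set s g (g b) = {m'..n'}"
      using int ab(2) unfolding is_interval_def by blast
    have lev: "x \<in> level_set s g (g x)" "h x \<in> level_set s g (g x)" if "x \<in> {1..s}" for x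
      using that Sym_mem[OF stabD(1)[OF h], of x] by (auto simp: level_set_def stabD(2)[OF h])
    have disj: "{m..n} \<inter> {m'..n'} = {}"
      using ab(3) unfolding mn[symmetric] mn'[symmetric] by (auto simp: level_set_def)
    show ?thesis
    proof (rule ccontr)
      assume "\<not> h a < h b"
      moreover have "a \<in> {m..n}" "h a \<in> {m..n}" "b \<in> {m'..n'}" "h b \<in> {m'..n'}"
        using lev[OF ab(1)] lev[OF ab(2)] unfolding mn mn' by blast+
      \<comment> \<open>Here \<open>a < b\<close> but \<open>h b \<le> h a\<close>, with
        \<open>a\<close>, \<open>h a\<close> in the first interval and \<open>b\<close>,
        \<open>h b\<close> in the second; so the intervals would overlap, with this common
        point.\<close>
      ultimately have "max a m' \<in> {m..n} \<inter> {m'..n'}"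
        using ab(4) by auto
      then show False using disj by blast
    qed
  qed
  show "orientation_descends s g T"
    unfolding orientation_descends_iff_monotone
  proof (intro ballI impI)
    fix w i assume w: "w \<in> Sym s" and i: "i \<in> {1..<s}" and ne: "g (w i) \<noteq> g (w (Suc i))"
    have mem: "w i \<in> {1..s}" "w (Suc i) \<in> {1..s}" using i Sym_mem[OF w] by auto
    have "w i \<noteq> w (Suc i)" using ne by auto
    then consider "w i < w (Suc i)" | "w (Suc i) < w i" by linarith
    then show "(\<forall>h\<in>stab s g. h (w i) < h (w (Suc i))) \<or> (\<forall>h\<in>stab s g. h (w (Suc i)) < h (w i))"
      using mono[OF mem ne] mono[OF mem(2,1) ne[symmetric]] by cases blast+
  qed
next
  assume desc: "orientation_descends s g T"
  show "\<forall>a\<in>g ` {1..s}. is_interval (level_set s g a)"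
  proof
    fix a assume "a \<in> g ` {1..s}"
    let ?I = "level_set s g a"
    have fin: "finite ?I" and ne: "?I \<noteq> {}"
      using \<open>a \<in> g ` {1..s}\<close> by (auto simp: level_set_def)
    \<comment> \<open>A gap \<open>q\<close> between the extremes of a level set would lie strictly
      between two points of equal level.\<close>
    have "q \<in> ?I" if q: "Min ?I \<le> q" "q \<le> Max ?I" for q
    proof (rule ccontr)
      assume "q \<notin> ?I"
      define p r where "p = Min ?I" and "r = Max ?I"
      have pr: "p \<in> ?I" "r \<in> ?I" using Min_in[OF fin ne] Max_in[OF fin ne] by (auto simp: p_def r_def)
      have lt: "p < q" "q < r"
        using q pr \<open>q \<notin> ?I\<close> unfolding p_def r_def by (metis le_neq_implies_less)+
      have bounds: "1 \<le> p" "r \<le> s" and g_eq: "g p = a" "g r = a" using pr by (auto simp: level_set_def)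
      have g_q: "g q \<noteq> a" using \<open>q \<notin> ?I\<close> lt bounds by (auto simp: level_set_def)
      \<comment> \<open>Puts \<open>p\<close> and \<open>q\<close> at positions 1 and 2, so that
        their comparison becomes an edge with label 1. The transpositions do not interfere because
        \<open>q\<close> is neither 1 nor \<open>p\<close>.\<close>
      define w where "w = transpose p 1 \<circ> transpose q 2"
      have "w \<in> Sym s"
        unfolding w_def using lt bounds by (intro Sym_comp) (auto simp: sym_group_carrier intro!: permutes_swap_id)
      have w1: "w 1 = p" and w2: "w 2 = q"
        using lt bounds by (auto simp: w_def transpose_def)
      \<comment> \<open>Exchanging \<open>p\<close> and \<open>r\<close> moves \<open>p\<close> past
        \<open>q\<close>, while \<open>id\<close> leaves it before \<open>q\<close>: two lifts of
        one edge point in opposite directions.\<close>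
      let ?h = "transpose p r"
      have id: "id \<in> stab s g" by (intro stabI id_Sym) simp
      have h: "?h \<in> stab s g"
        using lt bounds g_eq
        by (intro stabI) (auto simp: sym_group_carrier transpose_def intro!: permutes_swap_id)
      have one: "1 \<in> {1..<s}" using lt bounds by auto
      have "g (w 1) \<noteq> g (w (Suc 1))"
        unfolding Suc_1 w1 w2 using g_eq(1) g_q by simp
      then have "(\<forall>h\<in>stab s g. h (w 1) < h (w (Suc 1))) \<or> (\<forall>h\<in>stab s g. h (w (Suc 1)) < h (w 1))"
        using desc \<open>w \<in> Sym s\<close> one unfolding orientation_descends_iff_monotone by blast
      then have "(\<forall>h\<in>stab s g. h p < h q) \<or> (\<forall>h\<in>stab s g. h q < h p)"
        unfolding Suc_1 w1 w2 .
      then show False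
      proof
        assume "\<forall>h\<in>stab s g. h p < h q"
        from bspec[OF this h] show False using lt by (simp add: transpose_def split: if_splits)
      next
        assume "\<forall>h\<in>stab s g. h q < h p"
        from bspec[OF this id] show False using lt by simp
      qed
    qed
    then have "{Min ?I..Max ?I} \<subseteq> ?I" by (intro subsetI) simp
    moreover have "?I \<subseteq> {Min ?I..Max ?I}"
      using Min_le[OF fin] Max_ge[OF fin] by (intro subsetI) (simp only: atLeastAtMost_iff)
    ultimately have "?I = {Min ?I..Max ?I}" by (rule antisym[rotated])
    then show "is_interval ?I" unfolding is_interval_def by blast
  qed
qed

end

section \<open>Isomorphism classes of the endomorphism algebras\<close>

lemma tilting_lmodule: "tilting A M \<Longrightarrow> lmodule A M"
  unfolding tilting_def fg_module_def by blast

lemma mod_iso_refl: "mod_iso A M M"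
  unfolding mod_iso_def by (rule bexI[of _ id]) (auto simp: mod_hom_def)

context fd_local_principal_algebra
begin

lemma ideal_rad_power: "ideal (rad_power \<O> n) \<O>"
proof (rule uniformizer)
  fix p assume "p \<in> carrier \<O>" "\<And>n. rad_power \<O> n = PIdl\<^bsub>\<O>\<^esub> (p [^]\<^bsub>\<O>\<^esub> n)"
  then show "ideal (rad_power \<O> n) \<O>" by (simp add: cgenideal_ideal)
qed

lemma lmodule_chain_module: "lmodule \<O> (chain_module \<O> s h)"
proof -
  interpret S: quotient_sum \<O> s "\<lambda>i. rad_power \<O> (partial_sum h i)"
    by (intro quotient_sum.intro quotient_sum_axioms.intro M_cring ideal_rad_power)
  show ?thesis
    using S.lmodule_qsum unfolding S.qsum_def chain_module_def .
qed

text \<open>The scalar \<open>r\<close> acts on modules over the chain algebra through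
  \<open>c\<close>. As multiplication by an element of the commutative ring \<open>\<O>\<close>, it
  commutes with every \<open>\<O>\<close>-linear map.\<close>

lemma chain_alg_scalar_central:
  fixes s :: nat and h :: "nat \<Rightarrow> nat"
  assumes r: "r \<in> carrier R"
  defines "c \<equiv> r \<odot>\<^bsub>chain_alg \<O> s h\<^esub> \<one>\<^bsub>chain_alg \<O> s h\<^esub>"
  shows "c \<in> carrier (chain_alg \<O> s h)"
    and "f \<in> carrier (chain_alg \<O> s h) \<Longrightarrow>
      c \<otimes>\<^bsub>chain_alg \<O> s h\<^esub> f = f \<otimes>\<^bsub>chain_alg \<O> s h\<^esub> c"
proof -
  let ?M = "chain_module \<O> s h"
  interpret L: lmodule \<O> ?M by (rule lmodule_chain_module)
  let ?a = "r \<odot>\<^bsub>\<O>\<^esub> \<one>\<^bsub>\<O>\<^esub>"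
  have a: "?a \<in> carrier \<O>" using r by simp
  have c: "c = (\<lambda>x\<in>carrier ?M. ?a \<odot>\<^bsub>?M\<^esub> x)"
    unfolding c_def chain_alg_def End_alg_sel by (rule restrict_ext) simp
  show cc: "c \<in> carrier (chain_alg \<O> s h)"
    unfolding c chain_alg_def
  proof (rule End_algI)
    fix b x assume bx: "b \<in> carrier \<O>" "x \<in> carrier ?M"
    have "?a \<otimes>\<^bsub>\<O>\<^esub> b = b \<otimes>\<^bsub>\<O>\<^esub> ?a" by (rule m_comm[OF a bx(1)])
    then have "?a \<odot>\<^bsub>?M\<^esub> (b \<odot>\<^bsub>?M\<^esub> x) = b \<odot>\<^bsub>?M\<^esub> (?a \<odot>\<^bsub>?M\<^esub> x)"
      using L.smult_assoc[OF a bx] L.smult_assoc[OF bx(1) a bx(2)] by simp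
    then show "(\<lambda>x\<in>carrier ?M. ?a \<odot>\<^bsub>?M\<^esub> x) (b \<odot>\<^bsub>?M\<^esub> x) = b \<odot>\<^bsub>?M\<^esub> (\<lambda>x\<in>carrier ?M. ?a \<odot>\<^bsub>?M\<^esub> x) x"
      using bx L.smult_closed[OF bx] by simp
  next
    fix x y assume xy: "x \<in> carrier ?M" "y \<in> carrier ?M"
    then show "(\<lambda>x\<in>carrier ?M. ?a \<odot>\<^bsub>?M\<^esub> x) (x \<oplus>\<^bsub>?M\<^esub> y) =
        (\<lambda>x\<in>carrier ?M. ?a \<odot>\<^bsub>?M\<^esub> x) x \<oplus>\<^bsub>?M\<^esub> (\<lambda>x\<in>carrier ?M. ?a \<odot>\<^bsub>?M\<^esub> x) y"
      using L.M.add.m_closed[OF xy] L.smult_r_distr[OF a xy] by simp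
  qed (use L.smult_closed[OF a] in simp_all)
  show "c \<otimes>\<^bsub>chain_alg \<O> s h\<^esub> f = f \<otimes>\<^bsub>chain_alg \<O> s h\<^esub> c" if f: "f \<in> carrier (chain_alg \<O> s h)"
    unfolding chain_alg_def End_alg_sel compose_def
  proof (rule restrict_ext)
    note f' = f[unfolded chain_alg_def]
    fix x assume x: "x \<in> carrier ?M"
    show "c (f x) = f (c x)"
      unfolding c using x End_algD(1)[OF f' x] End_algD(3)[OF f' a x] by simp
  qed
qed

lemma
  assumes "lmodule (chain_alg \<O> s g) M"
  shows ring_end_op: "ring (end_op \<O> s g M)"
    and end_op_smult_closed:
      "r \<in> carrier R \<Longrightarrow> f \<in> carrier (end_op \<O> s g M) \<Longrightarrow> r \<odot>\<^bsub>end_op \<O> s g M\<^esub> f \<in> carrier (end_op \<O> s g M)"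
proof -
  let ?A = "chain_alg \<O> s g"
  interpret L: lmodule ?A M by (rule assms)
  show "ring (end_op \<O> s g M)"
    unfolding end_op_def by (rule op_alg_ring[OF End_alg_ring[OF assms]])
  assume r: "r \<in> carrier R" and "f \<in> carrier (end_op \<O> s g M)"
  then have f: "f \<in> carrier (End_alg ?A M)" by (simp add: end_op_def)
  let ?c = "r \<odot>\<^bsub>?A\<^esub> \<one>\<^bsub>?A\<^esub>"
  note c = chain_alg_scalar_central[OF r, where s = s and h = g]
  have "(\<lambda>x\<in>carrier M. ?c \<odot>\<^bsub>M\<^esub> f x) \<in> carrier (End_alg ?A M)"
  proof (rule End_algI)
    fix x y assume xy: "x \<in> carrier M" "y \<in> carrier M"
    show "(\<lambda>x\<in>carrier M. ?c \<odot>\<^bsub>M\<^esub> f x) (x \<oplus>\<^bsub>M\<^esub> y) =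
        (\<lambda>x\<in>carrier M. ?c \<odot>\<^bsub>M\<^esub> f x) x \<oplus>\<^bsub>M\<^esub> (\<lambda>x\<in>carrier M. ?c \<odot>\<^bsub>M\<^esub> f x) y"
      using xy L.M.add.m_closed[OF xy] End_algD(2)[OF f xy]
        L.smult_r_distr[OF c(1) End_algD(1)[OF f xy(1)] End_algD(1)[OF f xy(2)]] by simp
  next
    fix a x assume a: "a \<in> carrier ?A" and x: "x \<in> carrier M"
    have fx: "f x \<in> carrier M" by (rule End_algD(1)[OF f x])
    \<comment> \<open>Centrality of \<open>?c\<close> keeps the scalar multiple of \<open>f\<close>
      linear over the noncommutative algebra.\<close>
    have "?c \<odot>\<^bsub>M\<^esub> (a \<odot>\<^bsub>M\<^esub> f x) = a \<odot>\<^bsub>M\<^esub> (?c \<odot>\<^bsub>M\<^esub> f x)"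
      using L.smult_assoc[OF c(1) a fx] L.smult_assoc[OF a c(1) fx] c(2)[OF a] by simp
    then show "(\<lambda>x\<in>carrier M. ?c \<odot>\<^bsub>M\<^esub> f x) (a \<odot>\<^bsub>M\<^esub> x) = a \<odot>\<^bsub>M\<^esub> (\<lambda>x\<in>carrier M. ?c \<odot>\<^bsub>M\<^esub> f x) x"
      using x L.smult_closed[OF a x] End_algD(3)[OF f a x] by simp
  qed (use L.smult_closed[OF c(1) End_algD(1)[OF f]] in simp_all)
  then show "r \<odot>\<^bsub>end_op \<O> s g M\<^esub> f \<in> carrier (end_op \<O> s g M)"
    by (simp only: end_op_def op_alg_sel End_alg_sel)
qed

end

lemma (in tilting_family) injective_tilts: "injective_tilts s T"
proof
  show "inj_on (tilt s T) (Sym s)"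
  proof (rule inj_onI)
    fix u v assume "u \<in> Sym s" "v \<in> Sym s" "tilt s T u = tilt s T v"
    then show "u = v" using irredundant[of u v] mod_iso_refl[of "chain_alg \<O> s g" "tilt s T v"] by simp
  qed
qed

text \<open>The family identifies the two sides with the chain algebras of
  \<open>g \<circ> u\<close> and \<open>g \<circ> v\<close>, and a chain algebra determines its
  tuple.\<close>

lemma end_op_iso_iff:
  assumes "fd_local_principal_algebra R \<O>"
    and pos: "\<forall>i\<in>{1..s}. g i > 0"
    and loewy: "loewy_length \<O> = (\<Sum>i = 1..s. g i)"
    and "tilting_family R \<O> s g T"
    and u: "u \<in> Sym s" and v: "v \<in> Sym s"
  shows "alg_iso R (end_op \<O> s g (tilt s T u)) (end_op \<O> s g (tilt s T v)) \<longleftrightarrow> g \<circ> u = g \<circ> v"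
proof -
  interpret F: fd_local_principal_algebra R \<O> by (rule assms)
  interpret T: tilting_family R \<O> s g T by (rule assms)
  let ?E = "\<lambda>w. end_op \<O> s g (tilt s T w)"
  have lm: "lmodule (chain_alg \<O> s g) (tilt s T w)" if "w \<in> Sym s" for w
    using T.tilting[OF that] by (rule tilting_lmodule)
  have to: "alg_iso R (?E w) (chain_alg \<O> s (g \<circ> w))" if "w \<in> Sym s" for w
    using that by (rule T.end_op_tilt)
  have "from": "alg_iso R (chain_alg \<O> s (g \<circ> w)) (?E w)" if "w \<in> Sym s" for w
    by (rule alg_iso_sym[OF to[OF that] F.ring_end_op[OF lm[OF that]] F.end_op_smult_closed[OF lm[OF that]]])
  show ?thesis
  proof
    assume "g \<circ> u = g \<circ> v"
    then show "alg_iso R (?E u) (?E v)"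
      using alg_iso_trans[OF to[OF u]] "from"[OF v] by simp
  next
    assume "alg_iso R (?E u) (?E v)"
    then have "alg_iso R (chain_alg \<O> s (g \<circ> u)) (chain_alg \<O> s (g \<circ> v))"
      using alg_iso_trans[OF alg_iso_trans[OF "from"[OF u]] to[OF v]] by simp
    then obtain f where f: "f \<in> ring_iso (chain_alg \<O> s (g \<circ> u)) (chain_alg \<O> s (g \<circ> v))"
      unfolding alg_iso_def by blast
    \<comment> \<open>\<open>g \<circ> w\<close> permutes the entries of \<open>g\<close>, hence has
      positive entries and the same sum.\<close>
    have pos': "0 < (g \<circ> w) i" if "w \<in> Sym s" "i \<in> {1..s}" for w i
      using pos Sym_mem[OF that(1), of i] that(2) by simp
    have sum': "(\<Sum>i = 1..s. (g \<circ> w) i) = loewy_length \<O>" if "w \<in> Sym s" for w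
      using that sum.permute[of w "{1..s}" g] by (simp add: loewy sym_group_carrier)
    have "(g \<circ> u) i = (g \<circ> v) i" for i
    proof (cases "i \<in> {1..s}")
      case True
      show ?thesis
        by (rule F.chain_alg_iso_imp_eq[OF f pos'[OF u] sum'[OF u] pos'[OF v] sum'[OF v] True])
    next
      case False
      then show ?thesis
        using u v by (simp add: sym_group_carrier permutes_not_in)
    qed
    then show "g \<circ> u = g \<circ> v" by (rule ext)
  qed
qed

text \<open>The condition on \<open>\<alpha>\<close> says that the graph isomorphism is the one
  induced by sending each tilting module to its permutation, which is more than an abstract
  isomorphism.\<close>

theorem theorem1p4:
  fixes R :: "('r, 'x) ring_scheme"
    and \<O> :: "('r, 'a) module"
    and s :: nat
    and g :: "nat \<Rightarrow> nat"
    and T :: "(nat \<Rightarrow> nat) \<Rightarrow> nat \<Rightarrow> ((nat \<Rightarrow> 'a set) \<Rightarrow> (nat \<Rightarrow> 'a set), 'm) module"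
  assumes "fd_local_principal_algebra R \<O>"
    and "\<forall>i\<in>{1..s}. g i > 0"
    and "loewy_length \<O> = (\<Sum>i = 1..s. g i)"
    and "tilting_family R \<O> s g T"
  shows "(\<forall>u\<in>Sym s. \<forall>v\<in>Sym s.
            alg_iso R (end_op \<O> s g (tilt s T u)) (end_op \<O> s g (tilt s T v)) \<longleftrightarrow>
            stab s g #>\<^bsub>sym_group s\<^esub> u = stab s g #>\<^bsub>sym_group s\<^esub> v)
       \<and> lverts (mutation_quotient s g T) =
            lverts (mutation_graph s T) // end_op_rel R \<O> s g T
       \<and> (\<exists>\<alpha> \<beta>. lgraph_iso (mutation_quotient s g T) (schreier_graph s (stab s g)) \<alpha> \<beta> \<and>
            (\<forall>w\<in>Sym s. \<alpha> (orbit (stab_group s g) (vertex_act s T) (tilt s T w)) =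
               stab s g #>\<^bsub>sym_group s\<^esub> w))
       \<and> (orientation_descends s g T \<longleftrightarrow> (\<forall>a\<in>g ` {1..s}. is_interval (level_set s g a)))"
proof -
  interpret T: tilting_family R \<O> s g T by (rule assms)
  interpret G: injective_tilts s g T by (rule T.injective_tilts)
  let ?E = "\<lambda>w. end_op \<O> s g (tilt s T w)"
  let ?rel = "end_op_rel R \<O> s g T"
  have iso: "alg_iso R (?E u) (?E v) \<longleftrightarrow> G.C u = G.C v" if "u \<in> Sym s" "v \<in> Sym s" for u v
    unfolding end_op_iso_iff[OF assms that] coset_eq_iff[OF that] ..
  have verts: "lverts (mutation_graph s T) = tilt s T ` Sym s"
    by (simp add: mutation_graph_def)
  \<comment> \<open>Isomorphism classes and orbits agree because both are governed by the tuple
    \<open>g \<circ> w\<close>.\<close>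
  have class_eq: "?rel `` {tilt s T w} = tilt s T ` G.C w" if w: "w \<in> Sym s" for w
  proof -
    have "v \<in> G.C w \<longleftrightarrow> alg_iso R (?E w) (?E v)" if v: "v \<in> Sym s" for v
      unfolding mem_coset_iff[OF w v] end_op_iso_iff[OF assms w v] ..
    then have "G.C w = {v \<in> Sym s. alg_iso R (?E w) (?E v)}"
      using coset_subset[OF w, of g] by blast
    moreover have "?rel `` {tilt s T w} = tilt s T ` {v \<in> Sym s. alg_iso R (?E w) (?E v)}"
      using w unfolding end_op_rel_def verts by blast
    ultimately show ?thesis by (simp only:)
  qed
  have "lverts (mutation_graph s T) // ?rel = (\<lambda>w. ?rel `` {tilt s T w}) ` Sym s"
    unfolding verts quotient_def by blast
  also have "\<dots> = lverts (mutation_quotient s g T)"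
    unfolding G.lverts_Q by (intro image_cong refl class_eq)
  finally have quotient: "lverts (mutation_quotient s g T) = lverts (mutation_graph s T) // ?rel" ..
  have "G.coset_of_orbit (orbit (stab_group s g) (vertex_act s T) (tilt s T w)) = G.C w"
    if "w \<in> Sym s" for w
    unfolding G.vertex_orbit[OF that] by (rule G.coset_of_orbit[OF that])
  then have "\<exists>\<alpha> \<beta>. lgraph_iso (mutation_quotient s g T) (schreier_graph s (stab s g)) \<alpha> \<beta> \<and>
      (\<forall>w\<in>Sym s. \<alpha> (orbit (stab_group s g) (vertex_act s T) (tilt s T w)) = G.C w)"
    using G.quotient_iso_schreier by blast
  with iso quotient G.orientation_descends_iff show ?thesis
    by (intro conjI ballI)
qed

end
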